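(* Suppose that the uncertainty set is defined by a single truncated ellipsoidal constraint per group, i.e. $\mathcal V=\{v\in\mathbb R^{nm}: (v_G-\bar v_G)^\top S_G^{-1}(v_G-\bar v_G)\le r_G^2\ \text{ for all }G\in\mathcal G,\ v\succeq0\}$. Then the robust group egalitarian welfare problem $\max_{a\in\mathcal A}\min_{v\in\mathcal V}\min_{G\in\mathcal G}u_G(a,v)=\max_{a\in\mathcal A}\min_{v\in\mathcal V}\min_{G\in\mathcal G}a_G^\top v_G$ is equivalent to solving $$\max_{\lambda\in\mathbb R_{\ge0}^{g},\ \xi\in\Lambda}\ \min_{G\in\mathcal G}\ \ \xi_G^\top\bar v_G-\frac{\xi_G^\top S_G\xi_G}{4\lambda_G}-\lambda_Gr_G^2.\qquad(\ast)$$ The exact optimal solution $(\lambda^*,\xi^* )$ to $(\ast)$ can be computed by alternately performing two steps until convergence: first, fixing $\xi$ and optimizing $\lambda$, i.e. $\lambda_G=\xi_G^\top S_G\xi_G/(2r_G)$ for all $G\in\mathcal G$; and second, fixing $\lambda$ and solving a concave quadratic program to optimize $\xi$. The optimal allocation $a^*$ can be computed from $\xi^*$ by finding $a\in\mathcal A$ such that $a_G\preceq\xi^*_G$ for every group $G\in\mathcal G$.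
   Context: There are $n$ agents $N$, partitioned into $g$ groups $\mathcal G=\{G_1,\dots,G_g\}$, and $m$ item types $I$. Allocations and valuations are $n\times m$ matrices, vectorized in row-major order as $a,v\in\mathbb R^{nm}$; $x_G\in\mathbb R^{|G|m}$ is the restriction of a vector $x$ to the agents in $G$; $x_{j,i}$ is the entry of $x$ for agent $j$ and item $i$. $\succeq,\preceq$ are coordinatewise. The set of feasible (continuous) allocations $\mathcal A$ consists of all $a\in\mathbb R_{\ge0}^{nm}$ with $\underline\kappa_j\le\sum_{i\in I}a_{j,i}\le\bar\kappa_j$ for each agent $j$, $\underline\psi_i\le\sum_{j\in N}a_{j,i}\le\bar\psi_i$ for each item $i$, and $a\preceq c$, for given bounds $\underline\kappa,\bar\kappa,\underline\psi,\bar\psi,c$. Group egalitarian welfare is the minimum over groups of group utility; the factor $1/|G|$ in the group utility is absorbed into the valuations and the uncertainty set, so the utility of $G$ is $u_G(a,v)=a_G^\top v_G$. The data of $\mathcal V$ are centers $\bar v_G\in\mathbb R_{\ge0}^{|G|m}$, positive semi-definite covariance matrices $S_G$ (whose inverses are used) and radii $r_G\in\mathbb R$; thus $\mathcal V$ is a Cartesian product of independent uncertainty sets for the groups. The set $\Lambda$ is given as $$\Lambda\doteq\mathcal A-\mathbb R_{\ge0}^{nm}=\Bigl\{\xi\in\mathbb R^{nm}:\ \sum_{i\in I}\xi_{j,i}\le\bar\kappa_j\ \forall j\in N,\ \ \sum_{j\in N}\xi_{j,i}\le\bar\psi_i\ \forall i\in I,\ \ \xi\preceq c\Bigr\}.$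$
   Formalization: Corrected: Λ is A−R≥0 (the displayed set differs); λ_G=√(ξ_G^T S_G ξ_G)/(2r_G); a* satisfies ξ*_G⪯a_G; alternation needs r_G>0 and no λ_G vanishing, with values converging and limit points optimal; the max in (∗) is claimed attained only for A nonempty and all r_G≠0. *)

theory Defs
  imports "HOL-Analysis.Analysis"
begin

text \<open>
  Agents are the elements of a finite type \<open>'n\<close>, item types those of a finite type \<open>'m\<close>; a vectorized
  \<open>n \<times> m\<close> matrix is a vector of type \<open>real ^ ('n \<times> 'm)\<close>, with entry \<open>x $ (j, i)\<close> for agent \<open>j\<close> and
  item \<open>i\<close>. The \<open>g\<close> groups are indexed by a finite type \<open>'g\<close>, and \<open>G h\<close> is the set of agents of
  group \<open>h\<close>. The order on vectors is coordinatewise.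
\<close>

definition feasible ::
  "real ^ 'n \<Rightarrow> real ^ 'n \<Rightarrow> real ^ 'm \<Rightarrow> real ^ 'm \<Rightarrow> real ^ ('n \<times> 'm) \<Rightarrow> (real ^ ('n::finite \<times> 'm::finite)) set"
  where
  "feasible \<kappa>l \<kappa>u \<psi>l \<psi>u c =
     {a. 0 \<le> a \<and> a \<le> c \<and>
         (\<forall>j. \<kappa>l $ j \<le> (\<Sum>i\<in>UNIV. a $ (j, i)) \<and> (\<Sum>i\<in>UNIV. a $ (j, i)) \<le> \<kappa>u $ j) \<and>
         (\<forall>i. \<psi>l $ i \<le> (\<Sum>j\<in>UNIV. a $ (j, i)) \<and> (\<Sum>j\<in>UNIV. a $ (j, i)) \<le> \<psi>u $ i)}"

text \<open>
  The Minkowski difference of \<open>A\<close> and the nonnegative orthant. For the feasible set it is contained in,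
  but in general different from, the polyhedron cut out by the upper bounds alone: for one agent, two
  items, \<open>\<kappa>u = 1\<close>, \<open>\<psi>u\<close> and \<open>c\<close> equal to \<open>10\<close> and all lower bounds \<open>0\<close>, the point \<open>(10, -10)\<close>
  satisfies the upper bounds but lies below no feasible allocation.
\<close>

definition lower_shift :: "(real ^ 'k) set \<Rightarrow> (real ^ 'k::finite) set"
  where "lower_shift A = {a - \<mu> | a \<mu>. a \<in> A \<and> 0 \<le> \<mu>}"

text \<open>
  Vectors restricted to a group, and matrices of order \<open>|G| m\<close>, are represented by the
  entries of full-size objects on the index block of the group; the other entries are never read.
\<close>

definition block :: "'n set \<Rightarrow> ('n \<times> 'm) set"
  where "block H = H \<times> UNIV"

definition dot_on :: "'k set \<Rightarrow> real ^ 'k \<Rightarrow> real ^ 'k::finite \<Rightarrow> real"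
  where "dot_on K x y = (\<Sum>p\<in>K. x $ p * y $ p)"

definition quad_on :: "'k set \<Rightarrow> real ^ 'k ^ 'k \<Rightarrow> real ^ 'k::finite \<Rightarrow> real"
  where "quad_on K M x = (\<Sum>p\<in>K. \<Sum>q\<in>K. x $ p * M $ p $ q * x $ q)"

definition psd_on :: "'k set \<Rightarrow> real ^ 'k ^ 'k::finite \<Rightarrow> bool"
  where "psd_on K M \<longleftrightarrow> (\<forall>p\<in>K. \<forall>q\<in>K. M $ p $ q = M $ q $ p) \<and> (\<forall>x. 0 \<le> quad_on K M x)"

definition inverses_on :: "'k set \<Rightarrow> real ^ 'k ^ 'k \<Rightarrow> real ^ 'k ^ 'k::finite \<Rightarrow> bool"
  where "inverses_on K M T \<longleftrightarrow>
    (\<forall>p\<in>K. \<forall>q\<in>K. (\<Sum>k\<in>K. M $ p $ k * T $ k $ q) = (if p = q then 1 else 0) \<and>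
                  (\<Sum>k\<in>K. T $ p $ k * M $ k $ q) = (if p = q then 1 else 0))"

definition invertible_on :: "'k set \<Rightarrow> real ^ 'k ^ 'k::finite \<Rightarrow> bool"
  where "invertible_on K M \<longleftrightarrow> (\<exists>T. inverses_on K M T)"

text \<open>The submatrix analogue of \<open>matrix_inv\<close>; its entries on \<open>K \<times> K\<close> are uniquely determined.\<close>

definition matrix_inv_on :: "'k set \<Rightarrow> real ^ 'k ^ 'k \<Rightarrow> real ^ 'k ^ 'k::finite"
  where "matrix_inv_on K M = (SOME T. inverses_on K M T)"

definition uncertainty ::
  "('g \<Rightarrow> 'n set) \<Rightarrow> real ^ ('n \<times> 'm) \<Rightarrow> ('g \<Rightarrow> real ^ ('n \<times> 'm) ^ ('n \<times> 'm)) \<Rightarrow> ('g \<Rightarrow> real) \<Rightarrow>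
     (real ^ ('n::finite \<times> 'm::finite)) set"
  where
  "uncertainty G vbar S r =
     {v. (\<forall>h. quad_on (block (G h)) (matrix_inv_on (block (G h)) (S h)) (v - vbar) \<le> (r h)\<^sup>2) \<and> 0 \<le> v}"

definition group_utility ::
  "('g \<Rightarrow> 'n set) \<Rightarrow> 'g \<Rightarrow> real ^ ('n \<times> 'm) \<Rightarrow> real ^ ('n::finite \<times> 'm::finite) \<Rightarrow> real"
  where "group_utility G h a v = dot_on (block (G h)) a v"

definition robust_welfare ::
  "('g \<Rightarrow> 'n set) \<Rightarrow> (real ^ ('n \<times> 'm)) set \<Rightarrow> real ^ ('n::finite \<times> 'm::finite) \<Rightarrow> ereal"
  where "robust_welfare G V a = (INF v\<in>V. INF h. ereal (group_utility G h a v))"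

text \<open>
  The division is the one of \<open>ereal\<close>: at \<open>l = 0\<close> the quotient is \<open>0\<close> if the quadratic form
  vanishes and \<open>\<infinity>\<close> if it is positive, which is the closure of \<open>(q, l) \<mapsto> q / (4 * l)\<close> for \<open>l > 0\<close>.
  Real division, with \<open>x / 0 = 0\<close>, would remove the robustness penalty at \<open>l = 0\<close>.
\<close>

definition dual_term ::
  "('g \<Rightarrow> 'n set) \<Rightarrow> real ^ ('n \<times> 'm) \<Rightarrow> ('g \<Rightarrow> real ^ ('n \<times> 'm) ^ ('n \<times> 'm)) \<Rightarrow> ('g \<Rightarrow> real) \<Rightarrow>
     'g \<Rightarrow> real \<Rightarrow> real ^ ('n::finite \<times> 'm::finite) \<Rightarrow> ereal"
  where
  "dual_term G vbar S r h l \<xi> =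
     ereal (dot_on (block (G h)) \<xi> vbar)
     - ereal (quad_on (block (G h)) (S h) \<xi>) / ereal (4 * l)
     - ereal (l * (r h)\<^sup>2)"

definition dual_objective ::
  "('g \<Rightarrow> 'n set) \<Rightarrow> real ^ ('n \<times> 'm) \<Rightarrow> ('g \<Rightarrow> real ^ ('n \<times> 'm) ^ ('n \<times> 'm)) \<Rightarrow> ('g \<Rightarrow> real) \<Rightarrow>
     real ^ 'g \<Rightarrow> real ^ ('n::finite \<times> 'm::finite) \<Rightarrow> ereal"
  where "dual_objective G vbar S r lam \<xi> = (INF h. dual_term G vbar S r h (lam $ h) \<xi>)"

definition is_max_on :: "('a \<Rightarrow> ereal) \<Rightarrow> 'a set \<Rightarrow> 'a \<Rightarrow> bool"
  where "is_max_on f X x \<longleftrightarrow> x \<in> X \<and> (\<forall>y\<in>X. f y \<le> f x)"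

text \<open>
  The maximizer of \<open>l \<mapsto> - q / (4 * l) - l * r\<^sup>2\<close> over \<open>l \<ge> 0\<close>, with \<open>q\<close> the quadratic form and
  \<open>r > 0\<close>; note the square root.
\<close>

definition lambda_step ::
  "('g \<Rightarrow> 'n set) \<Rightarrow> ('g \<Rightarrow> real ^ ('n \<times> 'm) ^ ('n \<times> 'm)) \<Rightarrow> ('g \<Rightarrow> real) \<Rightarrow>
     real ^ ('n::finite \<times> 'm::finite) \<Rightarrow> real ^ 'g::finite"
  where "lambda_step G S r \<xi> = (\<chi> h. sqrt (quad_on (block (G h)) (S h) \<xi>) / (2 * r h))"

text \<open>
  Any maximizer may be chosen in the second step, so one start may admit several runs.
\<close>

definition alternating_run ::
  "('g \<Rightarrow> 'n set) \<Rightarrow> real ^ ('n \<times> 'm) \<Rightarrow> ('g \<Rightarrow> real ^ ('n \<times> 'm) ^ ('n \<times> 'm)) \<Rightarrow> ('g \<Rightarrow> real) \<Rightarrow>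
     (real ^ ('n \<times> 'm)) set \<Rightarrow> (nat \<Rightarrow> real ^ 'g::finite) \<Rightarrow> (nat \<Rightarrow> real ^ ('n::finite \<times> 'm::finite)) \<Rightarrow> bool"
  where
  "alternating_run G vbar S r \<Lambda> lam \<xi> \<longleftrightarrow>
     \<xi> 0 \<in> \<Lambda> \<and>
     (\<forall>k. lam k = lambda_step G S r (\<xi> k)) \<and>
     (\<forall>k. is_max_on (dual_objective G vbar S r (lam k)) \<Lambda> (\<xi> (Suc k)))"

end

theory Submission
  imports Defs
begin

text \<open>
  For one group, weak duality is the Cauchy-Schwarz inequality
  \<open>\<bar>x\<^sup>T w\<bar> \<le> sqrt (x\<^sup>T S x) * sqrt (w\<^sup>T S\<^sup>-\<^sup>1 w)\<close>, and eliminating the multiplier turns the dual term into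
  the worst case \<open>\<xi>\<^sup>T vbar - \<bar>r\<bar> * sqrt (\<xi>\<^sup>T S \<xi>)\<close>. For strong duality, smooth the square root to
  \<open>sqrt (\<xi>\<^sup>T S \<xi> + \<delta>)\<close> and maximize over \<open>\<xi> \<le> a\<close>: the gradient at a maximizer is nonnegative, vanishes
  where \<open>\<xi> < a\<close> and lies in the ellipsoid, so it is a valuation in the uncertainty set that is optimal
  up to an error of order \<open>sqrt \<delta>\<close>. The blocks are disjoint, so the groups can be treated separately.

  The alternating steps increase the worst value. At a limit point \<open>x\<close> of value \<open>L\<close> below the maximum,
  move slightly towards a maximizer. For groups with a positive limit multiplier the dual term agrees with
  the worst case to first order at \<open>x\<close>, so it gets above \<open>L\<close>. The other groups have worst case \<open>0\<close> at
  \<open>x\<close>, so \<open>L \<le> 0\<close>, and scaling their block proportionally to the multiplier gets above \<open>L\<close> as well.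
  The feasible region of the dual is closed under such blockwise scalings by factors in \<open>[0, 1]\<close>, so a
  later step of the run would exceed \<open>L\<close>.
\<close>

section \<open>Bilinear and quadratic forms on an index block\<close>

definition bil_on :: "'k set \<Rightarrow> real ^ 'k ^ 'k \<Rightarrow> real ^ 'k \<Rightarrow> real ^ 'k::finite \<Rightarrow> real"
  where "bil_on K M x y = (\<Sum>p\<in>K. \<Sum>q\<in>K. x $ p * M $ p $ q * y $ q)"

definition mult_on :: "'k set \<Rightarrow> real ^ 'k ^ 'k \<Rightarrow> real ^ 'k \<Rightarrow> real ^ 'k::finite"
  where "mult_on K M x = (\<chi> p. \<Sum>q\<in>K. M $ p $ q * x $ q)"

lemma quad_on_eq_bil_on: "quad_on K M x = bil_on K M x x"
  by (simp add: quad_on_def bil_on_def)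

lemma bil_on_eq_dot_on: "bil_on K M x y = dot_on K x (mult_on K M y)"
  by (simp add: bil_on_def dot_on_def mult_on_def sum_distrib_left mult.assoc)

lemma dot_on_cong: "(\<And>p. p \<in> K \<Longrightarrow> x $ p = x' $ p) \<Longrightarrow> (\<And>p. p \<in> K \<Longrightarrow> y $ p = y' $ p) \<Longrightarrow>
    dot_on K x y = dot_on K x' y'"
  by (simp add: dot_on_def)

lemma quad_on_cong: "(\<And>p. p \<in> K \<Longrightarrow> x $ p = y $ p) \<Longrightarrow> quad_on K M x = quad_on K M y"
  by (simp add: quad_on_def)

lemma dot_on_commute: "dot_on K x y = dot_on K y x"
  by (simp add: dot_on_def mult.commute)

lemma dot_on_left_linear:
  "dot_on K (x + y) z = dot_on K x z + dot_on K y z"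
  "dot_on K (x - y) z = dot_on K x z - dot_on K y z"
  "dot_on K (t *\<^sub>R x) z = t * dot_on K x z"
  "dot_on K 0 z = 0"
  by (simp_all add: dot_on_def algebra_simps sum.distrib sum_subtractf sum_distrib_left)

lemma dot_on_right_linear:
  "dot_on K z (x + y) = dot_on K z x + dot_on K z y"
  "dot_on K z (x - y) = dot_on K z x - dot_on K z y"
  "dot_on K z (t *\<^sub>R x) = t * dot_on K z x"
  by (simp_all add: dot_on_commute[of K z] dot_on_left_linear)

lemma dot_on_mono:
  "(\<And>p. p \<in> K \<Longrightarrow> x $ p \<le> y $ p) \<Longrightarrow> (\<And>p. p \<in> K \<Longrightarrow> 0 \<le> z $ p) \<Longrightarrow> dot_on K x z \<le> dot_on K y z"
  unfolding dot_on_def by (intro sum_mono mult_right_mono)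

lemma dot_on_axis: "p \<in> K \<Longrightarrow> dot_on K x (axis p 1) = x $ p"
  by (simp add: dot_on_def axis_def if_distrib cong: if_cong)

lemma quad_on_axis: "p \<in> K \<Longrightarrow> quad_on K M (axis p 1) = M $ p $ p"
proof -
  assume p: "p \<in> K"
  have "quad_on K M (axis p 1) = mult_on K M (axis p 1) $ p"
    by (simp add: quad_on_eq_bil_on bil_on_eq_dot_on dot_on_commute[of K "axis p 1"] dot_on_axis[OF p])
  also have "\<dots> = M $ p $ p"
    using dot_on_axis[OF p, of "M $ p"] by (simp add: mult_on_def dot_on_def)
  finally show ?thesis .
qed

lemma quad_on_scaleR: "quad_on K M (t *\<^sub>R x) = t\<^sup>2 * quad_on K M x"
  by (simp add: quad_on_def power2_eq_square sum_distrib_left mult_ac)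

lemma quad_on_zero [simp]: "quad_on K M 0 = 0"
  by (simp add: quad_on_def)

lemma continuous_on_dot_on [continuous_intros]:
  "continuous_on X f \<Longrightarrow> continuous_on X g \<Longrightarrow> continuous_on X (\<lambda>x. dot_on K (f x) (g x))"
  unfolding dot_on_def by (intro continuous_intros)

lemma continuous_on_quad_on [continuous_intros]:
  "continuous_on X f \<Longrightarrow> continuous_on X (\<lambda>x. quad_on K M (f x))"
  unfolding quad_on_def by (intro continuous_intros)

lemma bil_on_commute:
  assumes "psd_on K M" shows "bil_on K M x y = bil_on K M y x"
proof -
  have "bil_on K M x y = (\<Sum>p\<in>K. \<Sum>q\<in>K. x $ q * M $ q $ p * y $ p)"
    unfolding bil_on_def by (rule sum.swap)
  also have "\<dots> = bil_on K M y x"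
    unfolding bil_on_def using assms by (intro sum.cong) (auto simp: psd_on_def)
  finally show ?thesis .
qed

lemma quad_on_add_scaleR:
  assumes "psd_on K M"
  shows "quad_on K M (x + t *\<^sub>R d) = quad_on K M x + 2 * t * bil_on K M x d + t\<^sup>2 * quad_on K M d"
proof -
  have left: "bil_on K M (x + t *\<^sub>R d) y = bil_on K M x y + t * bil_on K M d y" for y
    by (simp add: bil_on_eq_dot_on dot_on_left_linear)
  have right: "bil_on K M y (x + t *\<^sub>R d) = bil_on K M y x + t * bil_on K M y d" for y
    using left[of y] by (simp add: bil_on_commute[OF assms, of y])
  show ?thesis
    unfolding quad_on_eq_bil_on left right
    by (simp add: bil_on_commute[OF assms, of d x] power2_eq_square algebra_simps)
qed

lemma quad_on_nonneg: "psd_on K M \<Longrightarrow> 0 \<le> quad_on K M x"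
  by (simp add: psd_on_def)

text \<open>The polynomial \<open>t \<mapsto> quad_on K M (x + t *\<^sub>R y)\<close> is
  nonnegative, and its value at the vertex gives the inequality. If the leading coefficient
  \<open>?y\<close> vanishes it is affine in \<open>t\<close>, so its slope must vanish too.\<close>

lemma bil_on_Cauchy_Schwarz:
  assumes "psd_on K M" shows "(bil_on K M x y)\<^sup>2 \<le> quad_on K M x * quad_on K M y"
proof -
  let ?b = "bil_on K M x y" and ?x = "quad_on K M x" and ?y = "quad_on K M y"
  have nonneg: "0 \<le> ?x + 2 * t * ?b + t\<^sup>2 * ?y" for t
    using quad_on_nonneg[OF assms, of "x + t *\<^sub>R y"] by (simp add: quad_on_add_scaleR[OF assms])
  show ?thesis
  proof (cases "?y = 0")
    case True
    have "?b = 0"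
    proof (rule ccontr)
      assume "?b \<noteq> 0"
      \<comment> \<open>At the chosen \<open>t\<close> the affine polynomial takes the value
        -1.\<close>
      then show False
        using nonneg[of "- (?x + 1) / (2 * ?b)"] True by (simp add: field_simps)
    qed
    then show ?thesis using True by simp
  next
    case False
    then have y: "?y > 0" using quad_on_nonneg[OF assms, of y] by linarith
    have "?x + 2 * (- ?b / ?y) * ?b + (- ?b / ?y)\<^sup>2 * ?y = ?x - ?b\<^sup>2 / ?y"
      using y by (simp add: field_simps power2_eq_square)
    then have "0 \<le> ?x - ?b\<^sup>2 / ?y" using nonneg[of "- ?b / ?y"] by simp
    then show ?thesis using y by (simp add: field_simps)
  qed
qed

lemma bil_on_le_sqrt:
  assumes "psd_on K M" shows "\<bar>bil_on K M x y\<bar> \<le> sqrt (quad_on K M x) * sqrt (quad_on K M y)"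
  using real_sqrt_le_mono[OF bil_on_Cauchy_Schwarz[OF assms, of x y]] by (simp add: real_sqrt_mult)

lemma inverses_on_commute: "inverses_on K M T \<Longrightarrow> inverses_on K T M"
  by (auto simp: inverses_on_def)

lemma inverses_on_matrix_inv_on: "invertible_on K M \<Longrightarrow> inverses_on K M (matrix_inv_on K M)"
  unfolding invertible_on_def matrix_inv_on_def by (rule someI_ex)

lemma bil_on_mult_on_inverse:
  fixes x w :: "real ^ 'k::finite"
  assumes "inverses_on K M T" shows "bil_on K M x (mult_on K T w) = dot_on K x w"
proof -
  have "(\<Sum>k\<in>K. M $ p $ k * (\<Sum>q\<in>K. T $ k $ q * w $ q)) = w $ p" if p: "p \<in> K" for p
  proof -
    have "(\<Sum>k\<in>K. M $ p $ k * (\<Sum>q\<in>K. T $ k $ q * w $ q))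
        = (\<Sum>k\<in>K. \<Sum>q\<in>K. M $ p $ k * T $ k $ q * w $ q)"
      by (simp add: sum_distrib_left mult.assoc)
    also have "\<dots> = (\<Sum>q\<in>K. (\<Sum>k\<in>K. M $ p $ k * T $ k $ q) * w $ q)"
      by (subst sum.swap) (simp add: sum_distrib_right)
    also have "\<dots> = (\<Sum>q\<in>K. if p = q then w $ q else 0)"
      using assms p by (intro sum.cong) (auto simp: inverses_on_def)
    also have "\<dots> = w $ p" using p by simp
    finally show ?thesis .
  qed
  then show ?thesis
    by (simp add: bil_on_eq_dot_on dot_on_def mult_on_def)
qed

lemma quad_on_mult_on_inverse:
  assumes "inverses_on K M T" shows "quad_on K M (mult_on K T w) = quad_on K T w"
  by (simp add: quad_on_eq_bil_on bil_on_mult_on_inverse[OF assms] bil_on_eq_dot_on[of K T] dot_on_commute)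

text \<open>\<open>M\<close> cancels \<open>T\<close> on the block, so the dot product is the form
  of \<open>M\<close> between \<open>x\<close> and \<open>T w\<close>, and the form of
  \<open>M\<close> at \<open>T w\<close> is that of \<open>T\<close> at \<open>w\<close>.
  Cauchy-Schwarz for \<open>M\<close> then applies.\<close>

lemma dot_on_le_sqrt_quad_on:
  assumes "psd_on K M" "inverses_on K M T"
  shows "\<bar>dot_on K x w\<bar> \<le> sqrt (quad_on K M x) * sqrt (quad_on K T w)"
  using bil_on_le_sqrt[OF assms(1), of x "mult_on K T w"]
  by (simp add: bil_on_mult_on_inverse[OF assms(2)] quad_on_mult_on_inverse[OF assms(2)])

text \<open>Testing against a unit vector turns a bound on the quadratic form into bounds on the
  coordinates. Definiteness and the boundedness of sets of dual vectors rest on this.\<close>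

lemma coordinate_le_sqrt_quad_on:
  assumes "psd_on K M" "inverses_on K M T" "p \<in> K"
  shows "\<bar>x $ p\<bar> \<le> sqrt (quad_on K M x) * sqrt (T $ p $ p)"
  using dot_on_le_sqrt_quad_on[OF assms(1,2), of x "axis p 1"] assms(3)
  by (simp add: dot_on_axis quad_on_axis)

lemma coordinate_le_sqrt_quad_on_inverse:
  assumes "psd_on K M" "inverses_on K M T" "p \<in> K"
  shows "\<bar>w $ p\<bar> \<le> sqrt (M $ p $ p) * sqrt (quad_on K T w)"
  using dot_on_le_sqrt_quad_on[OF assms(1,2), of "axis p 1" w] assms(3)
  by (simp add: dot_on_axis quad_on_axis dot_on_commute[of K "axis p 1"])

text \<open>Through the coordinate bound, invertibility upgrades semidefiniteness to
  definiteness.\<close>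

lemma quad_on_eq_0_iff:
  assumes "psd_on K M" "inverses_on K M T"
  shows "quad_on K M x = 0 \<longleftrightarrow> (\<forall>p\<in>K. x $ p = 0)"
proof
  assume "quad_on K M x = 0"
  then show "\<forall>p\<in>K. x $ p = 0"
    using coordinate_le_sqrt_quad_on[OF assms, of _ x] by auto
qed (simp add: quad_on_def)

section \<open>Bounded sets and existence of maximizers\<close>

lemma bounded_coordinates:
  fixes X :: "(real ^ 'k::finite) set"
  assumes "\<And>p. \<exists>B. \<forall>x\<in>X. \<bar>x $ p\<bar> \<le> B"
  shows "bounded X"
proof -
  obtain B where B: "\<And>p x. x \<in> X \<Longrightarrow> \<bar>x $ p\<bar> \<le> B p" using assms by metis
  have "norm x \<le> (\<Sum>p\<in>UNIV. B p)" if "x \<in> X" for x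
    using norm_le_l1_cart[of x] sum_mono[of UNIV "\<lambda>p. \<bar>x $ p\<bar>" B] B[OF that] by fastforce
  then show ?thesis by (auto simp: bounded_iff)
qed

text \<open>An extreme value theorem for upper semicontinuous functions into \<open>ereal\<close>.
  The superlevel sets at attained levels from \<open>f x0\<close> upwards are compact and have the
  finite intersection property; a point common to all of them is a maximizer. Lower levels do not
  matter, so \<open>f\<close> may be \<open>-\<infinity>\<close> at other points.\<close>

lemma is_max_on_exists:
  fixes f :: "'a::t2_space \<Rightarrow> ereal"
  assumes x0: "x0 \<in> X" and cpt: "\<And>y. f x0 \<le> y \<Longrightarrow> compact {x \<in> X. y \<le> f x}"
  shows "\<exists>x. is_max_on f X x"
proof -
  let ?L = "\<lambda>z. {x \<in> X. f z \<le> f x}"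
  let ?Z = "{z \<in> X. f x0 \<le> f z}"
  have "?L x0 \<inter> \<Inter>(?L ` ?Z) \<noteq> {}"
  proof (rule compact_imp_fip)
    show "compact (?L x0)" by (simp add: cpt)
    show "closed T" if "T \<in> ?L ` ?Z" for T using that cpt compact_imp_closed by auto
    fix F assume F: "finite F" "F \<subseteq> ?L ` ?Z"
    obtain Z where Z: "finite Z" "Z \<subseteq> ?Z" "F = ?L ` Z"
      using finite_subset_image[OF F] by blast
    \<comment> \<open>Among the finitely many points defining the sets in \<open>F\<close>, one of
      largest value lies in all these sets.\<close>
    obtain z where z: "z \<in> insert x0 Z" "\<And>w. w \<in> insert x0 Z \<Longrightarrow> f w \<le> f z"
    proof -
      have "Max (f ` insert x0 Z) \<in> f ` insert x0 Z" using Z by (intro Max_in) auto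
      then obtain z where "z \<in> insert x0 Z" "Max (f ` insert x0 Z) = f z" by blast
      moreover have "f w \<le> Max (f ` insert x0 Z)" if "w \<in> insert x0 Z" for w
        using that Z by (intro Max_ge) auto
      ultimately show ?thesis using that by metis
    qed
    then have "z \<in> ?L x0 \<inter> \<Inter>F" using Z x0 by auto
    then show "?L x0 \<inter> \<Inter>F \<noteq> {}" by blast
  qed
  then obtain x where x: "x \<in> ?L x0" "\<And>z. z \<in> ?Z \<Longrightarrow> f z \<le> f x" by auto
  have "f z \<le> f x" if "z \<in> X" for z
    using x that by (cases "f x0 \<le> f z") (auto dest: order_trans)
  then show ?thesis using x by (auto simp: is_max_on_def)
qed

declare split_paired_All [simp del] split_paired_Ex [simp del]

section \<open>Duality for a single group\<close>

locale robust_groups =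
  fixes G :: "'g::finite \<Rightarrow> 'n::finite set"
    and vbar :: "real ^ ('n \<times> 'm::finite)"
    and S :: "'g \<Rightarrow> real ^ ('n \<times> 'm) ^ ('n \<times> 'm)"
    and r :: "'g \<Rightarrow> real"
  assumes inj_groups: "inj G"
    and partition: "partition_on UNIV (range G)"
    and vbar_nonneg: "0 \<le> vbar"
    and psd: "psd_on (block (G h)) (S h)"
    and invertible: "invertible_on (block (G h)) (S h)"
begin

abbreviation K :: "'g \<Rightarrow> ('n \<times> 'm) set" where "K h \<equiv> block (G h)"
abbreviation T :: "'g \<Rightarrow> real ^ ('n \<times> 'm) ^ ('n \<times> 'm)" where "T h \<equiv> matrix_inv_on (K h) (S h)"
abbreviation q :: "'g \<Rightarrow> real ^ ('n \<times> 'm) \<Rightarrow> real" where "q h \<equiv> quad_on (K h) (S h)"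
abbreviation V :: "(real ^ ('n \<times> 'm)) set" where "V \<equiv> uncertainty G vbar S r"

text \<open>The minimum of the utility of \<xi> over the ellipsoid of the group without the sign
  constraint on valuations. It is also the supremum of \<open>dual_term\<close> over the multipliers
  \<open>l \<ge> 0\<close>.\<close>

definition worst_case :: "'g \<Rightarrow> real ^ ('n \<times> 'm) \<Rightarrow> real"
  where "worst_case h \<xi> = dot_on (K h) \<xi> vbar - \<bar>r h\<bar> * sqrt (q h \<xi>)"

text \<open>Real-valued form of \<open>dual_term\<close>, faithful for \<open>0 < l\<close>.\<close>

definition payoff :: "'g \<Rightarrow> real \<Rightarrow> real ^ ('n \<times> 'm) \<Rightarrow> real"
  where "payoff h l \<xi> = dot_on (K h) \<xi> vbar - q h \<xi> / (4 * l) - l * (r h)\<^sup>2"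

lemma inverses: "inverses_on (K h) (S h) (T h)"
  by (rule inverses_on_matrix_inv_on[OF invertible])

lemma q_nonneg [simp]: "0 \<le> q h \<xi>"
  by (rule quad_on_nonneg[OF psd])

lemma q_eq_0_iff: "q h \<xi> = 0 \<longleftrightarrow> (\<forall>p\<in>K h. \<xi> $ p = 0)"
  by (rule quad_on_eq_0_iff[OF psd inverses])

lemma vbar_coord: "0 \<le> vbar $ p"
  using vbar_nonneg by (simp add: less_eq_vec_def)

lemma ex_block: "\<exists>h. p \<in> K h"
  using partition unfolding partition_on_def block_def by (cases p) fastforce

lemma block_unique: "p \<in> K h \<Longrightarrow> p \<in> K h' \<Longrightarrow> h = h'"
  using disjointD[OF partition_onD2[OF partition], of "G h" "G h'"] inj_groups
  by (auto simp: block_def dest: injD)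

text \<open>The blocks are disjoint, so choices made separately for each group assemble into one
  vector. This is how the product structure of the uncertainty set enters.\<close>

lemma glue: "\<exists>x :: real ^ ('n \<times> 'm). \<forall>h. \<forall>p\<in>K h. x $ p = f h $ p"
proof (intro exI allI ballI)
  fix h p assume p: "p \<in> K h"
  have "(THE h. p \<in> K h) = h" using p block_unique by (intro the_equality) auto
  then show "(\<chi> p. f (THE h. p \<in> K h) $ p) $ p = f h $ p" by simp
qed

lemma worst_case_cong: "(\<And>p. p \<in> K h \<Longrightarrow> x $ p = y $ p) \<Longrightarrow> worst_case h x = worst_case h y"
  using dot_on_cong[of "K h" x y vbar vbar] quad_on_cong[of "K h" x y "S h"] by (simp add: worst_case_def)

lemma payoff_cong: "(\<And>p. p \<in> K h \<Longrightarrow> x $ p = y $ p) \<Longrightarrow> payoff h l x = payoff h l y"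
  using dot_on_cong[of "K h" x y vbar vbar] quad_on_cong[of "K h" x y "S h"] by (simp add: payoff_def)

lemma dual_term_pos: "0 < l \<Longrightarrow> dual_term G vbar S r h l \<xi> = ereal (payoff h l \<xi>)"
  by (simp add: dual_term_def payoff_def)

lemma dual_term_zero:
  "dual_term G vbar S r h 0 \<xi> = (if q h \<xi> = 0 then ereal (dot_on (K h) \<xi> vbar) else - \<infinity>)"
proof (cases "q h \<xi> = 0")
  case False
  then have "0 < q h \<xi>" using q_nonneg[of h \<xi>] by linarith
  then show ?thesis by (simp add: dual_term_def divide_ereal_def zero_ereal_def[symmetric])
qed (simp add: dual_term_def zero_ereal_def[symmetric])

text \<open>Completing the square in the multiplier. The gap vanishes exactly where
  \<open>2 * l * \<bar>r h\<bar>\<close> equals the root of the quadratic form, which yields the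
  optimal multiplier and its uniqueness.\<close>

lemma payoff_eq_worst_case:
  assumes "0 < l"
  shows "payoff h l \<xi> = worst_case h \<xi> - (sqrt (q h \<xi>) - 2 * l * \<bar>r h\<bar>)\<^sup>2 / (4 * l)"
proof -
  have "(sqrt (q h \<xi>) - 2 * l * \<bar>r h\<bar>)\<^sup>2 = q h \<xi> - 4 * l * \<bar>r h\<bar> * sqrt (q h \<xi>) + 4 * l\<^sup>2 * (r h)\<^sup>2"
    by (simp add: power2_diff power_mult_distrib)
  then show ?thesis using assms
    by (simp add: payoff_def worst_case_def field_simps power2_eq_square)
qed

lemma dual_term_le_worst_case:
  assumes "0 \<le> l" shows "dual_term G vbar S r h l \<xi> \<le> ereal (worst_case h \<xi>)"
proof (cases "l = 0")
  case True
  then show ?thesis by (simp add: dual_term_zero worst_case_def)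
next
  case False
  then show ?thesis using assms by (simp add: dual_term_pos payoff_eq_worst_case)
qed

lemma dual_term_step:
  assumes "r h \<noteq> 0"
  shows "dual_term G vbar S r h (sqrt (q h \<xi>) / (2 * \<bar>r h\<bar>)) \<xi> = ereal (worst_case h \<xi>)"
proof (cases "q h \<xi> = 0")
  case True
  then show ?thesis by (simp add: dual_term_zero worst_case_def)
next
  case False
  then have "0 < q h \<xi>" by (simp add: less_le)
  then have "0 < sqrt (q h \<xi>) / (2 * \<bar>r h\<bar>)" using assms by simp
  then show ?thesis using assms by (simp add: dual_term_pos payoff_eq_worst_case)
qed

text \<open>For a zero radius and a nonzero form the supremum is approached only as \<open>l\<close>
  tends to infinity, hence the tolerance \<open>e\<close>.\<close>

lemma dual_term_approx:
  assumes "0 < e"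
  shows "\<exists>l\<ge>0. ereal (worst_case h \<xi> - e) \<le> dual_term G vbar S r h l \<xi>"
proof (cases "r h = 0")
  case False
  then show ?thesis
    using assms by (intro exI[of _ "sqrt (q h \<xi>) / (2 * \<bar>r h\<bar>)"]) (simp add: dual_term_step)
next
  case True
  \<comment> \<open>Large enough that the penalty \<open>q h \<xi> / (4 * l)\<close> is at most
    \<open>e\<close>; the summand 1 keeps \<open>l\<close> positive when the form vanishes.\<close>
  define l where "l = (q h \<xi> + 1) / (4 * e)"
  have l: "0 < l" using assms by (simp add: l_def add_nonneg_pos)
  have "q h \<xi> \<le> e * (4 * l)" using assms by (simp add: l_def)
  then have "q h \<xi> / (4 * l) \<le> e" using l by (simp add: divide_le_eq)
  then show ?thesis
    using l True by (intro exI[of _ l]) (simp add: dual_term_pos payoff_def worst_case_def)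
qed

lemma dual_term_less_lambda_step:
  assumes "0 < r h" "0 \<le> l" "l \<noteq> lambda_step G S r \<xi> $ h"
  shows "dual_term G vbar S r h l \<xi> < dual_term G vbar S r h (lambda_step G S r \<xi> $ h) \<xi>"
proof -
  have "dual_term G vbar S r h (lambda_step G S r \<xi> $ h) \<xi> = ereal (worst_case h \<xi>)"
    using dual_term_step[of h \<xi>] assms by (simp add: lambda_step_def)
  moreover have "dual_term G vbar S r h l \<xi> < ereal (worst_case h \<xi>)"
  proof (cases "l = 0")
    case True
    then have "q h \<xi> \<noteq> 0" using assms by (auto simp: lambda_step_def)
    then show ?thesis using True by (simp add: dual_term_zero)
  next
    case False
    then have "0 < l" using assms by simp
    moreover have "sqrt (q h \<xi>) - 2 * l * \<bar>r h\<bar> \<noteq> 0"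
      using assms by (auto simp: lambda_step_def field_simps)
    ultimately show ?thesis
      by (simp add: dual_term_pos payoff_eq_worst_case)
  qed
  ultimately show ?thesis by simp
qed

text \<open>On a segment from \<open>x\<close> to \<open>y\<close> the form lies below its linear
  interpolation by \<open>t * (1 - t) * q h (y - x)\<close>.\<close>

lemma concave_payoff:
  assumes "0 < l" shows "concave_on UNIV (payoff h l)"
  unfolding concave_on_def
proof (rule convex_onI)
  fix t :: real and x y assume t: "0 < t" "t < 1"
  let ?d = "y - x" and ?b = "bil_on (K h) (S h) x (y - x)"
  have comb: "(1 - t) *\<^sub>R x + t *\<^sub>R y = x + t *\<^sub>R ?d" by (simp add: algebra_simps)
  have "q h y = q h x + 2 * ?b + q h ?d"
    using quad_on_add_scaleR[OF psd, of h x 1 ?d] by simp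
  then have "q h (x + t *\<^sub>R ?d) = (1 - t) * q h x + t * q h y - t * (1 - t) * q h ?d"
    unfolding quad_on_add_scaleR[OF psd] by (simp add: power2_eq_square algebra_simps)
  moreover have "0 \<le> t * (1 - t) * q h ?d" using t by simp
  ultimately have "q h (x + t *\<^sub>R ?d) / (4 * l) \<le> ((1 - t) * q h x + t * q h y) / (4 * l)"
    using assms by (intro divide_right_mono) auto
  then show "- payoff h l ((1 - t) *\<^sub>R x + t *\<^sub>R y) \<le> (1 - t) * - payoff h l x + t * - payoff h l y"
    unfolding comb by (simp add: payoff_def dot_on_left_linear algebra_simps add_divide_distrib diff_divide_distrib)
qed simp

text \<open>Weak duality. Cauchy-Schwarz compares \<xi> with \<open>v\<close> on the ellipsoid; the
  passage from \<xi> to \<open>a\<close> uses \<open>0 \<le> v\<close>. The slack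
  \<open>a - \<xi>\<close> is the multiplier of the sign constraint.\<close>

lemma worst_case_le_dot_on:
  assumes v: "v \<in> V" and le: "\<And>p. p \<in> K h \<Longrightarrow> \<xi> $ p \<le> a $ p"
  shows "worst_case h \<xi> \<le> dot_on (K h) a v"
proof -
  have v0: "0 \<le> v $ p" for p using v by (simp add: uncertainty_def less_eq_vec_def)
  have "quad_on (K h) (T h) (v - vbar) \<le> (r h)\<^sup>2" using v by (simp add: uncertainty_def)
  then have "sqrt (quad_on (K h) (T h) (v - vbar)) \<le> \<bar>r h\<bar>"
    using real_sqrt_le_mono by fastforce
  then have "sqrt (q h \<xi>) * sqrt (quad_on (K h) (T h) (v - vbar)) \<le> sqrt (q h \<xi>) * \<bar>r h\<bar>"
    by (intro mult_left_mono) auto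
  with dot_on_le_sqrt_quad_on[OF psd inverses, of h \<xi> "v - vbar"]
  have "- (\<bar>r h\<bar> * sqrt (q h \<xi>)) \<le> dot_on (K h) \<xi> (v - vbar)" by (simp add: mult.commute)
  then have "worst_case h \<xi> \<le> dot_on (K h) \<xi> v" by (simp add: worst_case_def dot_on_right_linear)
  also have "\<dots> \<le> dot_on (K h) a v" using le v0 by (intro dot_on_mono)
  finally show ?thesis .
qed

lemma dot_on_vbar_mono:
  "(\<And>p. p \<in> K h \<Longrightarrow> \<xi> $ p \<le> a $ p) \<Longrightarrow> dot_on (K h) \<xi> vbar \<le> dot_on (K h) a vbar"
  by (rule dot_on_mono) (simp_all add: vbar_coord)

text \<open>Strong duality up to \<open>e\<close>: the smoothed worst case is differentiable, and
  the first-order conditions at its maximizer below \<open>a\<close> produce the valuation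
  \<open>v\<close>.\<close>

lemma block_duality:
  assumes e: "0 < e"
  shows "\<exists>\<xi> v. (\<forall>p\<in>K h. \<xi> $ p \<le> a $ p) \<and> quad_on (K h) (T h) (v - vbar) \<le> (r h)\<^sup>2 \<and>
      (\<forall>p\<in>K h. 0 \<le> v $ p) \<and> dot_on (K h) a v \<le> worst_case h \<xi> + e"
proof (cases "r h = 0")
  case True
  then show ?thesis
    using e vbar_coord by (intro exI[of _ a] exI[of _ vbar]) (simp add: worst_case_def)
next
  case False
  define \<rho> where "\<rho> = \<bar>r h\<bar>"
  \<comment> \<open>Chosen so that \<open>\<rho> * sqrt \<delta>\<close>, the price of smoothing,
    equals \<open>e\<close>.\<close>
  define \<delta> where "\<delta> = (e / \<rho>)\<^sup>2"
  define g where "g \<xi> = dot_on (K h) \<xi> vbar - \<rho> * sqrt (q h \<xi> + \<delta>)" for \<xi>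
  \<comment> \<open>Coordinates outside the block do not affect \<open>g\<close>; fixing them at 0
    makes the superlevel sets bounded.\<close>
  define X where "X = {\<xi> :: real ^ ('n \<times> 'm). \<forall>p. (p \<in> K h \<longrightarrow> \<xi> $ p \<le> a $ p) \<and> (p \<notin> K h \<longrightarrow> \<xi> $ p = 0)}"
  define x0 where "x0 = (\<chi> p. if p \<in> K h then a $ p else 0)"
  have \<rho>: "0 < \<rho>" using False by (simp add: \<rho>_def)
  have \<delta>: "0 < \<delta>" using e \<rho> by (simp add: \<delta>_def)
  have cont: "continuous_on UNIV g"
    unfolding g_def by (intro continuous_intros)
  have x0: "x0 \<in> X" by (simp add: X_def x0_def)
  have "\<exists>\<xi>. is_max_on (\<lambda>\<xi>. ereal (g \<xi>)) X \<xi>"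
  proof (rule is_max_on_exists[OF x0])
    fix y assume y: "ereal (g x0) \<le> y"
    have "closed {\<xi>. \<forall>p. (p \<in> K h \<longrightarrow> \<xi> $ p \<le> a $ p) \<and> (p \<notin> K h \<longrightarrow> \<xi> $ p = 0)}"
      by (intro closed_Collect_all closed_Collect_conj closed_Collect_imp closed_Collect_le
          closed_Collect_eq continuous_intros) auto
    moreover have "closed {\<xi>. y \<le> ereal (g \<xi>)}"
      by (intro closed_Collect_le continuous_intros cont)
    ultimately have "closed {\<xi> \<in> X. y \<le> ereal (g \<xi>)}"
      unfolding X_def by (simp add: closed_Collect_conj)
    moreover have "bounded {\<xi> \<in> X. y \<le> ereal (g \<xi>)}"
    proof (rule bounded_coordinates)
      fix p
      define C where "C = (dot_on (K h) a vbar - g x0) / \<rho>"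
      have "\<bar>\<xi> $ p\<bar> \<le> \<bar>C\<bar> * \<bar>sqrt (T h $ p $ p)\<bar>" if \<xi>: "\<xi> \<in> X" "y \<le> ereal (g \<xi>)" for \<xi>
      proof (cases "p \<in> K h")
        case True
        have "g x0 \<le> g \<xi>" using y \<xi> by (metis ereal_less_eq(3) order_trans)
        moreover have "dot_on (K h) \<xi> vbar \<le> dot_on (K h) a vbar"
          using \<xi> by (intro dot_on_vbar_mono) (simp add: X_def)
        ultimately have "\<rho> * sqrt (q h \<xi> + \<delta>) \<le> dot_on (K h) a vbar - g x0"
          by (simp add: g_def)
        then have "sqrt (q h \<xi> + \<delta>) \<le> C" using \<rho> by (simp add: C_def field_simps)
        moreover have "sqrt (q h \<xi>) \<le> sqrt (q h \<xi> + \<delta>)" using \<delta> by simp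
        ultimately have "sqrt (q h \<xi>) \<le> \<bar>C\<bar>" by linarith
        then have "sqrt (q h \<xi>) * sqrt (T h $ p $ p) \<le> \<bar>C\<bar> * \<bar>sqrt (T h $ p $ p)\<bar>"
          by (intro order_trans[OF mult_left_mono mult_right_mono]) auto
        then show ?thesis
          using coordinate_le_sqrt_quad_on[OF psd inverses True, of \<xi>] by linarith
      next
        case False
        then show ?thesis using \<xi> by (simp add: X_def)
      qed
      then show "\<exists>B. \<forall>\<xi>\<in>{\<xi> \<in> X. y \<le> ereal (g \<xi>)}. \<bar>\<xi> $ p\<bar> \<le> B" by blast
    qed
    ultimately show "compact {\<xi> \<in> X. y \<le> ereal (g \<xi>)}" by (simp add: compact_eq_bounded_closed)
  qed
  then obtain \<xi> where \<xi>: "\<xi> \<in> X" and max: "\<And>x. x \<in> X \<Longrightarrow> g x \<le> g \<xi>"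
    by (auto simp: is_max_on_def)
  define s where "s = sqrt (q h \<xi> + \<delta>)"
  have s: "0 < s" using \<delta> by (simp add: s_def add_nonneg_pos)
  \<comment> \<open>On the block this is the gradient of \<open>g\<close> at \<xi>.\<close>
  define v where "v = vbar - (\<rho> / s) *\<^sub>R mult_on (K h) (S h) \<xi>"
  have deriv: "((\<lambda>t. g (\<xi> + t *\<^sub>R axis p 1)) has_real_derivative v $ p) (at 0)" if p: "p \<in> K h" for p
  proof -
    let ?b = "mult_on (K h) (S h) \<xi> $ p"
    have b: "bil_on (K h) (S h) \<xi> (axis p 1) = ?b"
      using bil_on_commute[OF psd, of h \<xi> "axis p 1"]
      by (simp add: bil_on_eq_dot_on[of _ _ "axis p 1"] dot_on_commute[of _ "axis p 1"] dot_on_axis[OF p])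
    have "g (\<xi> + t *\<^sub>R axis p 1) = dot_on (K h) \<xi> vbar + t * vbar $ p
        - \<rho> * sqrt (q h \<xi> + 2 * t * ?b + t\<^sup>2 * S h $ p $ p + \<delta>)" for t
      by (simp add: g_def quad_on_add_scaleR[OF psd] b quad_on_axis[OF p] dot_on_left_linear
          dot_on_commute[of _ "axis p 1"] dot_on_axis[OF p])
    moreover have "((\<lambda>t. dot_on (K h) \<xi> vbar + t * vbar $ p
        - \<rho> * sqrt (q h \<xi> + 2 * t * ?b + t\<^sup>2 * S h $ p $ p + \<delta>)) has_real_derivative v $ p) (at 0)"
      using s \<delta> by (auto intro!: derivative_eq_intros simp: v_def s_def field_simps add_nonneg_pos)
    ultimately show ?thesis by simp
  qed
  \<comment> \<open>Lowering a coordinate stays inside \<open>X\<close>, so a negative partial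
    derivative would contradict maximality.\<close>
  have v0: "0 \<le> v $ p" if p: "p \<in> K h" for p
  proof (rule ccontr)
    assume "\<not> 0 \<le> v $ p"
    then obtain d where d: "0 < d" "\<forall>t>0. t < d \<longrightarrow> g (\<xi> + 0 *\<^sub>R axis p 1) < g (\<xi> + (0 - t) *\<^sub>R axis p 1)"
      using DERIV_neg_dec_left[OF deriv[OF p]] by auto
    have "\<xi> + (0 - d / 2) *\<^sub>R axis p 1 \<in> X"
      using \<xi> d(1) p by (auto simp: X_def axis_def intro: order_trans[of _ "\<xi> $ p"])
    then show False using max d by (metis add.right_neutral field_sum_of_halves half_gt_zero less_add_same_cancel1 linorder_not_less scaleR_zero_left)
  qed
  \<comment> \<open>Complementary slackness: a coordinate with room below \<open>a\<close> could be
    raised if its partial derivative were positive.\<close>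
  have compl: "a $ p * v $ p = \<xi> $ p * v $ p" if p: "p \<in> K h" for p
  proof (rule ccontr)
    assume "a $ p * v $ p \<noteq> \<xi> $ p * v $ p"
    then have vp: "0 < v $ p" and lt: "\<xi> $ p < a $ p" using v0[OF p] \<xi> p by (auto simp: X_def less_le)
    obtain d where d: "0 < d" "\<forall>t>0. t < d \<longrightarrow> g (\<xi> + 0 *\<^sub>R axis p 1) < g (\<xi> + (0 + t) *\<^sub>R axis p 1)"
      using DERIV_pos_inc_right[OF deriv[OF p] vp] by auto
    define t where "t = min (d / 2) (a $ p - \<xi> $ p)"
    have t: "0 < t" "t < d" "\<xi> $ p + t \<le> a $ p" using d(1) lt by (auto simp: t_def)
    have "\<xi> + t *\<^sub>R axis p 1 \<in> X"
      using \<xi> t p by (auto simp: X_def axis_def)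
    then show False using max d(2) t by fastforce
  qed
  have "quad_on (K h) (T h) (v - vbar) = (\<rho> / s)\<^sup>2 * q h \<xi>"
  proof -
    have "v - vbar = (- (\<rho> / s)) *\<^sub>R mult_on (K h) (S h) \<xi>" by (simp add: v_def)
    then show ?thesis
      by (simp only: quad_on_scaleR quad_on_mult_on_inverse[OF inverses_on_commute[OF inverses]]) simp
  qed
  also have "\<dots> \<le> (\<rho> / s)\<^sup>2 * s\<^sup>2"
    using \<delta> by (intro mult_left_mono) (simp_all add: s_def)
  also have "\<dots> = (r h)\<^sup>2" using s by (simp add: power_divide \<rho>_def)
  finally have vq: "quad_on (K h) (T h) (v - vbar) \<le> (r h)\<^sup>2" .
  have "dot_on (K h) a v = dot_on (K h) \<xi> v" unfolding dot_on_def using compl by (rule sum.cong[OF refl])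
  also have "\<dots> = dot_on (K h) \<xi> vbar - \<rho> * (q h \<xi> / s)"
    by (simp add: v_def dot_on_right_linear bil_on_eq_dot_on[symmetric] quad_on_eq_bil_on)
  \<comment> \<open>The error is controlled by \<open>s - q h \<xi> / s = \<delta> / s \<le> sqrt
    \<delta> = e / \<rho>\<close>.\<close>
  also have "\<dots> \<le> worst_case h \<xi> + e"
  proof -
    have s2: "s * s = q h \<xi> + \<delta>" using \<delta> by (simp add: s_def add_nonneg_nonneg)
    have "e / \<rho> = sqrt \<delta>" using e \<rho> by (simp add: \<delta>_def)
    also have "\<dots> \<le> s" by (simp add: s_def)
    finally have "(e / \<rho>) * (e / \<rho>) \<le> (e / \<rho>) * s" using e \<rho> by (intro mult_left_mono) auto
    then have "s * s - q h \<xi> \<le> (e / \<rho>) * s" using s2 by (simp add: \<delta>_def power2_eq_square)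
    then have "s - q h \<xi> / s \<le> e / \<rho>" using s by (simp add: field_simps)
    moreover have "sqrt (q h \<xi>) \<le> s" using \<delta> by (simp add: s_def)
    ultimately have "sqrt (q h \<xi>) - q h \<xi> / s \<le> e / \<rho>" by linarith
    then have "\<rho> * (sqrt (q h \<xi>) - q h \<xi> / s) \<le> e"
      using \<rho> by (simp add: pos_le_divide_eq mult.commute)
    then show ?thesis by (simp add: worst_case_def \<rho>_def algebra_simps)
  qed
  finally have "dot_on (K h) a v \<le> worst_case h \<xi> + e" .
  moreover have "\<forall>p\<in>K h. \<xi> $ p \<le> a $ p" using \<xi> by (simp add: X_def)
  ultimately show ?thesis using v0 vq by blast
qed

end

section \<open>Minima over finitely many groups\<close>

lemma INF_ereal_finite:
  fixes f :: "'h::finite \<Rightarrow> real"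
  shows "(INF h. ereal (f h)) = ereal (MIN h. f h)"
proof (rule antisym)
  have "Min (range f) \<in> range f" by (rule Min_in) auto
  then obtain h where "Min (range f) = f h" by blast
  then show "(INF h. ereal (f h)) \<le> ereal (MIN h. f h)" by (metis INF_lower UNIV_I)
  show "ereal (MIN h. f h) \<le> (INF h. ereal (f h))" by (rule INF_greatest) simp
qed

lemma MIN_in: "\<exists>h. (MIN h. f h) = f (h :: 'h::finite)"
  for f :: "'h::finite \<Rightarrow> 'a::linorder"
proof -
  have "Min (range f) \<in> range f" by (rule Min_in) auto
  then show ?thesis by blast
qed

lemma tendsto_MIN:
  fixes f :: "'a \<Rightarrow> 'h::finite \<Rightarrow> real"
  assumes "\<And>h. ((\<lambda>x. f x h) \<longlongrightarrow> l h) F"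
  shows "((\<lambda>x. MIN h. f x h) \<longlongrightarrow> (MIN h. l h)) F"
proof -
  have "((\<lambda>x. Min ((\<lambda>h. f x h) ` H)) \<longlongrightarrow> Min (l ` H)) F" if "finite H" "H \<noteq> {}" for H
    using that
  proof (induction H rule: finite_ne_induct)
    case (singleton h)
    then show ?case using assms by simp
  next
    case (insert h H)
    then show ?case using assms by (auto intro!: tendsto_min)
  qed
  then show ?thesis by simp
qed

section \<open>Duality and attainment for a compact set of nonnegative allocations\<close>

locale robust_allocation = robust_groups G vbar S r
  for G :: "'g::finite \<Rightarrow> 'n::finite set"
    and vbar :: "real ^ ('n \<times> 'm::finite)"
    and S :: "'g \<Rightarrow> real ^ ('n \<times> 'm) ^ ('n \<times> 'm)"
    and r :: "'g \<Rightarrow> real" +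
  fixes A :: "(real ^ ('n \<times> 'm)) set"
  assumes compact_A: "compact A"
    and A_nonneg: "a \<in> A \<Longrightarrow> 0 \<le> a $ p"
begin

abbreviation \<Lambda> :: "(real ^ ('n \<times> 'm)) set" where "\<Lambda> \<equiv> lower_shift A"
abbreviation Dom :: "((real ^ 'g) \<times> (real ^ ('n \<times> 'm))) set" where "Dom \<equiv> {lam. 0 \<le> lam} \<times> \<Lambda>"
abbreviation obj :: "real ^ 'g \<Rightarrow> real ^ ('n \<times> 'm) \<Rightarrow> ereal" where "obj \<equiv> dual_objective G vbar S r"
abbreviation welfare :: "real ^ ('n \<times> 'm) \<Rightarrow> ereal" where "welfare \<equiv> robust_welfare G V"

definition worst_value :: "real ^ ('n \<times> 'm) \<Rightarrow> real"
  where "worst_value \<xi> = (MIN h. worst_case h \<xi>)"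

text \<open>
  For positive radii this is \<open>lambda_step\<close>; the absolute value keeps it nonnegative for all radii.
\<close>

definition best_multiplier :: "real ^ ('n \<times> 'm) \<Rightarrow> real ^ 'g"
  where "best_multiplier \<xi> = (\<chi> h. sqrt (q h \<xi>) / (2 * \<bar>r h\<bar>))"

lemma in_\<Lambda>_iff: "\<xi> \<in> \<Lambda> \<longleftrightarrow> (\<exists>a\<in>A. \<forall>p. \<xi> $ p \<le> a $ p)"
proof
  assume "\<exists>a\<in>A. \<forall>p. \<xi> $ p \<le> a $ p"
  then obtain a where "a \<in> A" "\<forall>p. \<xi> $ p \<le> a $ p" by blast
  then have "\<xi> = a - (a - \<xi>) \<and> a \<in> A \<and> 0 \<le> a - \<xi>" by (simp add: less_eq_vec_def)
  then show "\<xi> \<in> \<Lambda>" unfolding lower_shift_def by blast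
next
  assume "\<xi> \<in> \<Lambda>"
  then obtain a \<mu> where "a \<in> A" "0 \<le> \<mu>" "\<xi> = a - \<mu>" by (auto simp: lower_shift_def)
  then show "\<exists>a\<in>A. \<forall>p. \<xi> $ p \<le> a $ p" by (intro bexI[of _ a]) (auto simp: less_eq_vec_def)
qed

lemma zero_in_\<Lambda>: "A \<noteq> {} \<Longrightarrow> 0 \<in> \<Lambda>"
  using A_nonneg by (auto simp: in_\<Lambda>_iff)

text \<open>Allocations are nonnegative, so
  \<open>t * \<xi> $ p \<le> t * a $ p \<le> a $ p\<close>: the same \<open>a\<close> remains an
  upper bound. Blockwise scaling in the convergence proof relies on this.\<close>

lemma \<Lambda>_shrink:
  assumes "\<xi> \<in> \<Lambda>" and "\<And>p. \<exists>t. 0 \<le> t \<and> t \<le> 1 \<and> \<eta> $ p = t * \<xi> $ p"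
  shows "\<eta> \<in> \<Lambda>"
proof -
  obtain a where a: "a \<in> A" "\<And>p. \<xi> $ p \<le> a $ p" using assms(1) in_\<Lambda>_iff by blast
  have "\<eta> $ p \<le> a $ p" for p
  proof -
    obtain t where t: "0 \<le> t" "t \<le> 1" "\<eta> $ p = t * \<xi> $ p" using assms(2) by blast
    have "t * \<xi> $ p \<le> t * a $ p" using a t by (intro mult_left_mono) auto
    also have "\<dots> \<le> 1 * a $ p" using A_nonneg[OF a(1)] t by (intro mult_right_mono) auto
    finally show ?thesis using t by simp
  qed
  then show ?thesis using a in_\<Lambda>_iff by blast
qed

lemma closed_\<Lambda>: "closed \<Lambda>"
proof -
  have "closed (\<Union>x\<in>A. \<Union>y\<in>{0..}. {x - y})"
    by (rule compact_closed_differences[OF compact_A]) simp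
  moreover have "(\<Union>x\<in>A. \<Union>y\<in>{0..}. {x - y}) = \<Lambda>" by (auto simp: lower_shift_def)
  ultimately show ?thesis by simp
qed

text \<open>The region is unbounded below, but \<open>vbar\<close> is nonnegative, so the nominal
  utility is bounded by its values on the compact set \<open>A\<close>.\<close>

lemma \<Lambda>_dot_on_bounded: "\<exists>C. \<forall>\<xi>\<in>\<Lambda>. dot_on (K h) \<xi> vbar \<le> C"
proof -
  have "bounded ((\<lambda>a. dot_on (K h) a vbar) ` A)"
    by (intro compact_imp_bounded compact_continuous_image compact_A continuous_intros)
  then obtain C where C: "\<And>a. a \<in> A \<Longrightarrow> \<bar>dot_on (K h) a vbar\<bar> \<le> C" by (auto simp: bounded_iff)
  have "dot_on (K h) \<xi> vbar \<le> C" if \<xi>: "\<xi> \<in> \<Lambda>" for \<xi>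
  proof -
    obtain a where a: "a \<in> A" "\<And>p. \<xi> $ p \<le> a $ p" using \<xi> in_\<Lambda>_iff by blast
    then show ?thesis using C[OF a(1)] dot_on_vbar_mono[of h \<xi> a] by auto
  qed
  then show ?thesis by blast
qed

lemma convex_\<Lambda>_segment:
  assumes "convex A" "x \<in> \<Lambda>" "y \<in> \<Lambda>" "0 \<le> t" "t \<le> 1"
  shows "x + t *\<^sub>R (y - x) \<in> \<Lambda>"
proof -
  obtain a b where a: "a \<in> A" "\<And>p. x $ p \<le> a $ p" and b: "b \<in> A" "\<And>p. y $ p \<le> b $ p"
    using assms in_\<Lambda>_iff by metis
  have "(1 - t) *\<^sub>R a + t *\<^sub>R b \<in> A"
    using assms a b by (simp add: convex_alt)
  moreover have "(x + t *\<^sub>R (y - x)) $ p \<le> ((1 - t) *\<^sub>R a + t *\<^sub>R b) $ p" for p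
  proof -
    have "(1 - t) * x $ p + t * y $ p \<le> (1 - t) * a $ p + t * b $ p"
      using assms a b by (intro add_mono mult_left_mono) auto
    then show ?thesis by (simp add: algebra_simps)
  qed
  ultimately show ?thesis using in_\<Lambda>_iff by blast
qed

lemma worst_value_le: "worst_value \<xi> \<le> worst_case h \<xi>"
  by (simp add: worst_value_def)

lemma worst_value_in: "\<exists>h. worst_value \<xi> = worst_case h \<xi>"
  unfolding worst_value_def by (rule MIN_in)

lemma obj_le_dual_term: "obj lam \<xi> \<le> dual_term G vbar S r h (lam $ h) \<xi>"
  unfolding dual_objective_def by (rule INF_lower) simp

lemma obj_le_worst_value: "0 \<le> lam \<Longrightarrow> obj lam \<xi> \<le> ereal (worst_value \<xi>)"
  using worst_value_in[of \<xi>] obj_le_dual_term[of lam \<xi>] dual_term_le_worst_case[of "lam $ _" _ \<xi>]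
  by (metis less_eq_vec_def order_trans zero_index)

lemma best_multiplier_nonneg: "0 \<le> best_multiplier \<xi>"
  by (simp add: best_multiplier_def less_eq_vec_def)

lemma obj_best_multiplier:
  assumes "\<And>h. r h \<noteq> 0" shows "obj (best_multiplier \<xi>) \<xi> = ereal (worst_value \<xi>)"
  using assms by (simp add: dual_objective_def best_multiplier_def dual_term_step INF_ereal_finite worst_value_def)

text \<open>Each group has its own multiplier, so the multipliers can be chosen independently before
  taking the minimum over groups.\<close>

lemma obj_approx:
  assumes "0 < e" shows "\<exists>lam\<ge>0. ereal (worst_value \<xi> - e) \<le> obj lam \<xi>"
proof -
  have "\<forall>h. \<exists>l. 0 \<le> l \<and> ereal (worst_case h \<xi> - e) \<le> dual_term G vbar S r h l \<xi>"
    using dual_term_approx[OF assms] by blast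
  from choice[OF this] obtain l
    where l: "\<And>h. 0 \<le> l h" "\<And>h. ereal (worst_case h \<xi> - e) \<le> dual_term G vbar S r h (l h) \<xi>"
    by blast
  have "ereal (worst_value \<xi> - e) \<le> obj (\<chi> h. l h) \<xi>"
    unfolding dual_objective_def
  proof (rule INF_greatest)
    fix h
    have "ereal (worst_value \<xi> - e) \<le> ereal (worst_case h \<xi> - e)" using worst_value_le by simp
    from order_trans[OF this l(2)[of h]]
    show "ereal (worst_value \<xi> - e) \<le> dual_term G vbar S r h ((\<chi> h. l h) $ h) \<xi>" by simp
  qed
  then show ?thesis using l(1) by (intro exI[of _ "\<chi> h. l h"]) (simp add: less_eq_vec_def)
qed

lemma worst_value_le_welfare:
  assumes "\<And>p. \<xi> $ p \<le> a $ p" shows "ereal (worst_value \<xi>) \<le> welfare a"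
  unfolding robust_welfare_def group_utility_def
proof (intro INF_greatest)
  fix v h assume "v \<in> V"
  then have "worst_case h \<xi> \<le> dot_on (K h) a v" using assms by (intro worst_case_le_dot_on)
  then show "ereal (worst_value \<xi>) \<le> ereal (dot_on (K h) a v)" using worst_value_le[of \<xi> h] by simp
qed

lemma welfare_le: "v \<in> V \<Longrightarrow> welfare a \<le> ereal (dot_on (K h) a v)"
  unfolding robust_welfare_def group_utility_def by (rule INF_lower2, assumption, rule INF_lower) simp

text \<open>The pairs from \<open>block_duality\<close> are glued into one \<xi> and one valuation
  in \<open>V\<close>. The group attaining the worst value of \<xi> then bounds the welfare.\<close>

lemma welfare_approx:
  assumes "0 < e" shows "\<exists>\<xi>. (\<forall>p. \<xi> $ p \<le> a $ p) \<and> welfare a \<le> ereal (worst_value \<xi> + e)"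
proof -
  have "\<forall>h. \<exists>x w. (\<forall>p\<in>K h. x $ p \<le> a $ p) \<and> quad_on (K h) (T h) (w - vbar) \<le> (r h)\<^sup>2 \<and>
      (\<forall>p\<in>K h. 0 \<le> w $ p) \<and> dot_on (K h) a w \<le> worst_case h x + e"
    using block_duality[OF assms] by blast
  from choice[OF this] obtain x where "\<forall>h. \<exists>w. (\<forall>p\<in>K h. x h $ p \<le> a $ p) \<and>
      quad_on (K h) (T h) (w - vbar) \<le> (r h)\<^sup>2 \<and>
      (\<forall>p\<in>K h. 0 \<le> w $ p) \<and> dot_on (K h) a w \<le> worst_case h (x h) + e" by blast
  from choice[OF this] obtain w where xw: "\<And>h p. p \<in> K h \<Longrightarrow> x h $ p \<le> a $ p"
      "\<And>h. quad_on (K h) (T h) (w h - vbar) \<le> (r h)\<^sup>2" "\<And>h p. p \<in> K h \<Longrightarrow> 0 \<le> w h $ p"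
      "\<And>h. dot_on (K h) a (w h) \<le> worst_case h (x h) + e"
    by blast
  obtain \<xi> :: "real ^ ('n \<times> 'm)" where \<xi>: "\<And>h p. p \<in> K h \<Longrightarrow> \<xi> $ p = x h $ p"
    using glue[of x] by blast
  obtain v :: "real ^ ('n \<times> 'm)" where v: "\<And>h p. p \<in> K h \<Longrightarrow> v $ p = w h $ p"
    using glue[of w] by blast
  have le: "\<xi> $ p \<le> a $ p" for p
  proof -
    obtain h where h: "p \<in> K h" using ex_block by blast
    show ?thesis using xw(1)[OF h] \<xi>[OF h] by simp
  qed
  have "0 \<le> v $ p" for p
  proof -
    obtain h where h: "p \<in> K h" using ex_block by blast
    show ?thesis using xw(3)[OF h] v[OF h] by simp
  qed
  moreover have "quad_on (K h) (T h) (v - vbar) \<le> (r h)\<^sup>2" for h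
    using xw(2)[of h] quad_on_cong[of "K h" "v - vbar" "w h - vbar" "T h"] v[of _ h] by simp
  ultimately have vV: "v \<in> V" by (simp add: uncertainty_def less_eq_vec_def)
  obtain h where h: "worst_value \<xi> = worst_case h \<xi>" using worst_value_in by blast
  have "welfare a \<le> ereal (dot_on (K h) a v)" by (rule welfare_le[OF vV])
  also have "dot_on (K h) a v = dot_on (K h) a (w h)" using v by (intro dot_on_cong) auto
  also have "ereal \<dots> \<le> ereal (worst_case h (x h) + e)" using xw(4) by simp
  also have "worst_case h (x h) = worst_value \<xi>" using h worst_case_cong[of h \<xi> "x h"] \<xi> by simp
  finally show ?thesis using le by blast
qed

lemma obj_le_SUP_welfare:
  assumes "(lam, \<xi>) \<in> Dom" shows "obj lam \<xi> \<le> (SUP a\<in>A. welfare a)"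
proof -
  obtain a where a: "a \<in> A" "\<And>p. \<xi> $ p \<le> a $ p" using assms in_\<Lambda>_iff by auto
  have "obj lam \<xi> \<le> welfare a"
    using obj_le_worst_value[of lam \<xi>] worst_value_le_welfare[OF a(2)] assms by auto
  then show ?thesis using a(1) by (rule SUP_upper2[rotated])
qed

lemma SUP_welfare_eq: "(SUP a\<in>A. welfare a) = (SUP (lam, \<xi>)\<in>Dom. obj lam \<xi>)"
proof (rule antisym)
  show "(SUP (lam, \<xi>)\<in>Dom. obj lam \<xi>) \<le> (SUP a\<in>A. welfare a)"
    using obj_le_SUP_welfare by (intro SUP_least) auto
  show "(SUP a\<in>A. welfare a) \<le> (SUP (lam, \<xi>)\<in>Dom. obj lam \<xi>)"
  proof (rule SUP_least, rule ereal_le_epsilon2)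
    fix a and e' :: real assume a: "a \<in> A" and e': "0 < e'"
    \<comment> \<open>One half of the tolerance pays for replacing \<open>a\<close> by \<xi>, the
      other for multipliers that only nearly attain the worst value.\<close>
    define e where "e = e' / 2"
    have e: "0 < e" "2 * e = e'" using e' by (simp_all add: e_def)
    obtain \<xi> where \<xi>: "\<And>p. \<xi> $ p \<le> a $ p" "welfare a \<le> ereal (worst_value \<xi> + e)"
      using welfare_approx[OF e(1)] by blast
    obtain lam where lam: "0 \<le> lam" "ereal (worst_value \<xi> - e) \<le> obj lam \<xi>"
      using obj_approx[OF e(1)] by blast
    have "\<xi> \<in> \<Lambda>" using \<xi>(1) a in_\<Lambda>_iff by blast
    then have "(lam, \<xi>) \<in> Dom" using lam by simp
    then have "obj lam \<xi> \<le> (SUP (lam, \<xi>)\<in>Dom. obj lam \<xi>)" (is "_ \<le> ?s") by (rule SUP_upper2) simp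
    note \<xi>(2)
    also have "ereal (worst_value \<xi> + e) = ereal (worst_value \<xi> - e) + ereal e'" using e(2) by simp
    also have "\<dots> \<le> ?s + ereal e'"
      using lam(2) \<open>obj lam \<xi> \<le> ?s\<close> e(2) by (intro add_mono) auto
    finally show "welfare a \<le> ?s + ereal e'" .
  qed
qed

lemma vbar_in_V: "vbar \<in> V"
  by (simp add: uncertainty_def vbar_nonneg)

lemma compact_V: "compact V"
proof -
  have "closed {v. (\<forall>h. quad_on (K h) (T h) (v - vbar) \<le> (r h)\<^sup>2) \<and> (\<forall>p. 0 \<le> v $ p)}"
    by (intro closed_Collect_all closed_Collect_conj closed_Collect_le continuous_intros)
  then have "closed V" by (simp add: uncertainty_def less_eq_vec_def)
  moreover have "bounded V"
  proof (rule bounded_coordinates)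
    fix p
    obtain h where h: "p \<in> K h" using ex_block by blast
    have "\<bar>v $ p\<bar> \<le> \<bar>vbar $ p\<bar> + sqrt (S h $ p $ p) * \<bar>r h\<bar>" if v: "v \<in> V" for v
    proof -
      have "quad_on (K h) (T h) (v - vbar) \<le> (r h)\<^sup>2" using v by (simp add: uncertainty_def)
      then have "sqrt (quad_on (K h) (T h) (v - vbar)) \<le> \<bar>r h\<bar>"
        using real_sqrt_le_mono by fastforce
      moreover have "0 \<le> S h $ p $ p" using q_nonneg[of h "axis p 1"] quad_on_axis[OF h] by metis
      ultimately have "sqrt (S h $ p $ p) * sqrt (quad_on (K h) (T h) (v - vbar)) \<le> sqrt (S h $ p $ p) * \<bar>r h\<bar>"
        by (intro mult_left_mono) auto
      then show ?thesis
        using coordinate_le_sqrt_quad_on_inverse[OF psd inverses h, of "v - vbar"] by simp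
    qed
    then show "\<exists>B. \<forall>v\<in>V. \<bar>v $ p\<bar> \<le> B" by blast
  qed
  ultimately show ?thesis by (simp add: compact_eq_bounded_closed)
qed

text \<open>Each group has a minimizer over the compact set \<open>V\<close>; the group whose
  minimum is smallest attains both infima.\<close>

lemma welfare_attained: "\<exists>v\<in>V. \<exists>h. welfare a = ereal (dot_on (K h) a v)"
proof -
  have "\<exists>v\<in>V. \<forall>w\<in>V. dot_on (K h) a v \<le> dot_on (K h) a w" for h
    using vbar_in_V by (intro continuous_attains_inf compact_V continuous_intros) auto
  then obtain v where v: "\<And>h. v h \<in> V" "\<And>h w. w \<in> V \<Longrightarrow> dot_on (K h) a (v h) \<le> dot_on (K h) a w"
    by metis
  obtain h where h: "(MIN h. dot_on (K h) a (v h)) = dot_on (K h) a (v h)"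
    using MIN_in[of "\<lambda>h. dot_on (K h) a (v h)"] by blast
  have "welfare a = ereal (dot_on (K h) a (v h))"
  proof (rule antisym)
    show "ereal (dot_on (K h) a (v h)) \<le> welfare a"
      unfolding robust_welfare_def group_utility_def
    proof (intro INF_greatest)
      fix w h' assume w: "w \<in> V"
      have "(MIN h. dot_on (K h) a (v h)) \<le> dot_on (K h') a (v h')" by simp
      also have "\<dots> \<le> dot_on (K h') a w" by (rule v(2)[OF w])
      finally show "ereal (dot_on (K h) a (v h)) \<le> ereal (dot_on (K h') a w)" by (simp add: h)
    qed
  qed (rule welfare_le[OF v(1)])
  then show ?thesis using v(1) by blast
qed

text \<open>Welfare is an infimum of continuous functions of \<open>a\<close>, so its superlevel
  sets are closed in \<open>A\<close>.\<close>

lemma welfare_max_exists: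
  assumes "A \<noteq> {}" shows "\<exists>a. is_max_on welfare A a"
proof -
  obtain a0 where "a0 \<in> A" using assms by blast
  then show ?thesis
  proof (rule is_max_on_exists)
    fix y
    have "{a \<in> A. y \<le> welfare a} = A \<inter> (\<Inter>v\<in>V. \<Inter>h. {a. y \<le> ereal (dot_on (K h) a v)})"
      by (auto simp: robust_welfare_def group_utility_def le_INF_iff)
    moreover have "closed (\<Inter>v\<in>V. \<Inter>h. {a. y \<le> ereal (dot_on (K h) a v)})"
      by (intro closed_INT ballI closed_Collect_le continuous_intros)
    ultimately show "compact {a \<in> A. y \<le> welfare a}" using compact_A by (simp add: compact_Int_closed)
  qed
qed

lemma bounded_quadratic_forms:
  assumes "\<And>h. \<exists>B. \<forall>\<xi>\<in>X. q h \<xi> \<le> B" shows "bounded X"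
proof (rule bounded_coordinates)
  fix p
  obtain h where h: "p \<in> K h" using ex_block by blast
  obtain B where B: "\<And>\<xi>. \<xi> \<in> X \<Longrightarrow> q h \<xi> \<le> B" using assms by blast
  have "\<bar>\<xi> $ p\<bar> \<le> sqrt B * \<bar>sqrt (T h $ p $ p)\<bar>" if "\<xi> \<in> X" for \<xi>
  proof -
    have "\<bar>\<xi> $ p\<bar> \<le> sqrt (q h \<xi>) * sqrt (T h $ p $ p)"
      by (rule coordinate_le_sqrt_quad_on[OF psd inverses h])
    also have "\<dots> \<le> sqrt (q h \<xi>) * \<bar>sqrt (T h $ p $ p)\<bar>" by (intro mult_left_mono) auto
    also have "\<dots> \<le> sqrt B * \<bar>sqrt (T h $ p $ p)\<bar>"
      using B[OF that] by (intro mult_right_mono) auto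
    finally show ?thesis .
  qed
  then show "\<exists>B. \<forall>\<xi>\<in>X. \<bar>\<xi> $ p\<bar> \<le> B" by blast
qed

text \<open>The nominal utility is bounded above on the region, so a lower bound on the worst value
  bounds the penalty, and nonzero radii turn this into a bound on every quadratic form.\<close>

lemma bounded_worst_value_superlevel:
  assumes "\<And>h. r h \<noteq> 0" shows "bounded {\<xi> \<in> \<Lambda>. s \<le> worst_value \<xi>}"
proof (rule bounded_quadratic_forms)
  fix h
  obtain C where C: "\<And>\<xi>. \<xi> \<in> \<Lambda> \<Longrightarrow> dot_on (K h) \<xi> vbar \<le> C" using \<Lambda>_dot_on_bounded by blast
  have "q h \<xi> \<le> ((C - s) / \<bar>r h\<bar>)\<^sup>2" if "\<xi> \<in> \<Lambda>" "s \<le> worst_value \<xi>" for \<xi>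
  proof -
    have "s \<le> worst_case h \<xi>" using that(2) worst_value_le[of \<xi> h] by simp
    then have "\<bar>r h\<bar> * sqrt (q h \<xi>) \<le> C - s" using C[OF that(1)] by (simp add: worst_case_def)
    then have "sqrt (q h \<xi>) \<le> (C - s) / \<bar>r h\<bar>" using assms by (simp add: field_simps)
    then show ?thesis by (metis sqrt_le_D)
  qed
  then show "\<exists>B. \<forall>\<xi>\<in>{\<xi> \<in> \<Lambda>. s \<le> worst_value \<xi>}. q h \<xi> \<le> B" by blast
qed

lemma continuous_on_worst_case: "continuous_on X (worst_case h)"
  unfolding worst_case_def by (intro continuous_intros)

lemma worst_value_max_exists:
  assumes "A \<noteq> {}" "\<And>h. r h \<noteq> 0" shows "\<exists>\<xi>\<in>\<Lambda>. \<forall>x\<in>\<Lambda>. worst_value x \<le> worst_value \<xi>"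
proof -
  have "\<exists>\<xi>. is_max_on (\<lambda>\<xi>. ereal (worst_value \<xi>)) \<Lambda> \<xi>"
  proof (rule is_max_on_exists[OF zero_in_\<Lambda>[OF assms(1)]])
    fix y assume y: "ereal (worst_value 0) \<le> y"
    have "{\<xi> \<in> \<Lambda>. y \<le> ereal (worst_value \<xi>)} = \<Lambda> \<inter> (\<Inter>h. {\<xi>. y \<le> ereal (worst_case h \<xi>)})"
      by (auto simp: worst_value_def INF_ereal_finite[symmetric] le_INF_iff)
    moreover have "closed (\<Inter>h. {\<xi>. y \<le> ereal (worst_case h \<xi>)})"
      by (intro closed_INT ballI closed_Collect_le continuous_intros continuous_on_worst_case)
    ultimately have "closed {\<xi> \<in> \<Lambda>. y \<le> ereal (worst_value \<xi>)}" using closed_\<Lambda> by auto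
    moreover have "bounded {\<xi> \<in> \<Lambda>. y \<le> ereal (worst_value \<xi>)}"
      using y by (intro bounded_subset[OF bounded_worst_value_superlevel[OF assms(2), of "worst_value 0"]])
        (auto dest: order_trans)
    ultimately show "compact {\<xi> \<in> \<Lambda>. y \<le> ereal (worst_value \<xi>)}" by (simp add: compact_eq_bounded_closed)
  qed
  then show ?thesis by (auto simp: is_max_on_def)
qed

lemma obj_max_iff:
  assumes "(lam, \<xi>) \<in> Dom"
  shows "is_max_on (\<lambda>(lam, \<xi>). obj lam \<xi>) Dom (lam, \<xi>) \<longleftrightarrow> obj lam \<xi> = (SUP (lam, \<xi>)\<in>Dom. obj lam \<xi>)"
proof
  assume "is_max_on (\<lambda>(lam, \<xi>). obj lam \<xi>) Dom (lam, \<xi>)"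
  then show "obj lam \<xi> = (SUP (lam, \<xi>)\<in>Dom. obj lam \<xi>)"
    using assms by (intro antisym SUP_upper2[OF assms] SUP_least) (auto simp: is_max_on_def)
next
  assume "obj lam \<xi> = (SUP (lam, \<xi>)\<in>Dom. obj lam \<xi>)"
  moreover have "obj lam' \<xi>' \<le> (SUP (lam, \<xi>)\<in>Dom. obj lam \<xi>)" if "(lam', \<xi>') \<in> Dom" for lam' \<xi>'
    by (rule SUP_upper2[OF that]) simp
  ultimately show "is_max_on (\<lambda>(lam, \<xi>). obj lam \<xi>) Dom (lam, \<xi>)"
    using assms by (auto simp: is_max_on_def)
qed

lemma obj_max_on_Dom:
  assumes r: "\<And>h. r h \<noteq> 0" and \<xi>: "\<xi> \<in> \<Lambda>" and max: "\<And>x. x \<in> \<Lambda> \<Longrightarrow> worst_value x \<le> worst_value \<xi>"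
  shows "is_max_on (\<lambda>(lam, \<xi>). obj lam \<xi>) Dom (best_multiplier \<xi>, \<xi>)"
proof -
  have "obj lam x \<le> ereal (worst_value \<xi>)" if "(lam, x) \<in> Dom" for lam x
    using obj_le_worst_value[of lam x] max[of x] that by (auto intro: order_trans)
  then show ?thesis
    using \<xi> best_multiplier_nonneg by (auto simp: is_max_on_def obj_best_multiplier[OF r])
qed

lemma recovery:
  assumes "is_max_on (\<lambda>(lam, \<xi>). obj lam \<xi>) Dom (lam, \<xi>)" "a \<in> A" "\<And>p. \<xi> $ p \<le> a $ p"
  shows "is_max_on welfare A a"
proof -
  have dom: "(lam, \<xi>) \<in> Dom" using assms(1) by (simp add: is_max_on_def)
  have "(SUP a\<in>A. welfare a) = obj lam \<xi>"
    using obj_max_iff[OF dom] assms(1) SUP_welfare_eq by simp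
  also have "\<dots> \<le> ereal (worst_value \<xi>)" using dom by (intro obj_le_worst_value) auto
  also have "\<dots> \<le> welfare a" using assms(3) by (rule worst_value_le_welfare)
  finally have "(SUP a\<in>A. welfare a) \<le> welfare a" .
  then show ?thesis using assms(2) by (auto simp: is_max_on_def intro: order_trans[OF SUP_upper])
qed

lemma obj_pos:
  assumes "\<And>h. 0 < lam $ h" shows "obj lam \<xi> = ereal (MIN h. payoff h (lam $ h) \<xi>)"
  using assms by (simp add: dual_objective_def dual_term_pos INF_ereal_finite)

text \<open>A positive multiplier makes the quadratic penalty coercive on its block; a zero
  multiplier forces \<xi> to vanish there. Either way the relevant superlevel sets are
  compact.\<close>

lemma obj_max_exists:
  assumes "A \<noteq> {}" and lam: "0 \<le> lam"
  shows "\<exists>\<xi>. is_max_on (obj lam) \<Lambda> \<xi>"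
proof (rule is_max_on_exists[OF zero_in_\<Lambda>[OF assms(1)]])
  have lam0: "0 \<le> lam $ h" for h using lam by (simp add: less_eq_vec_def)
  \<comment> \<open>The value at the zero vector is finite, so levels above it exclude the points
    where some dual term is \<open>-\<infinity>\<close>.\<close>
  have dual0: "dual_term G vbar S r h (lam $ h) 0 = ereal (- (lam $ h * (r h)\<^sup>2))" for h
    using lam0[of h] by (cases "lam $ h = 0") (auto simp: dual_term_zero dual_term_pos payoff_def dot_on_left_linear)
  fix y assume "obj lam 0 \<le> y"
  then have y: "ereal (MIN h. - (lam $ h * (r h)\<^sup>2)) \<le> y"
    by (simp add: dual_objective_def dual0 INF_ereal_finite)
  let ?s = "MIN h. - (lam $ h * (r h)\<^sup>2)"
  have "closed {\<xi>. y \<le> dual_term G vbar S r h (lam $ h) \<xi>}" for h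
  proof (cases "lam $ h = 0")
    case True
    have "{\<xi>. y \<le> dual_term G vbar S r h (lam $ h) \<xi>} = {\<xi>. q h \<xi> = 0 \<and> y \<le> ereal (dot_on (K h) \<xi> vbar)}"
      using y True by (auto simp: dual_term_zero)
    also have "closed \<dots>"
      by (intro closed_Collect_conj closed_Collect_eq closed_Collect_le continuous_intros)
    finally show ?thesis .
  next
    case False
    then have "0 < lam $ h" using lam0[of h] by simp
    then show ?thesis
      by (simp add: dual_term_pos payoff_def) (intro closed_Collect_le continuous_intros, simp)
  qed
  then have "closed (\<Lambda> \<inter> (\<Inter>h. {\<xi>. y \<le> dual_term G vbar S r h (lam $ h) \<xi>}))"
    using closed_\<Lambda> by auto
  moreover have "{\<xi> \<in> \<Lambda>. y \<le> obj lam \<xi>} = \<Lambda> \<inter> (\<Inter>h. {\<xi>. y \<le> dual_term G vbar S r h (lam $ h) \<xi>})"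
    by (auto simp: dual_objective_def le_INF_iff)
  moreover have "bounded {\<xi> \<in> \<Lambda>. y \<le> obj lam \<xi>}"
  proof (rule bounded_quadratic_forms)
    fix h
    obtain C where C: "\<And>\<xi>. \<xi> \<in> \<Lambda> \<Longrightarrow> dot_on (K h) \<xi> vbar \<le> C" using \<Lambda>_dot_on_bounded by blast
    \<comment> \<open>The bound also covers a zero multiplier, where both sides are 0.\<close>
    have "q h \<xi> \<le> (C - lam $ h * (r h)\<^sup>2 - ?s) * (4 * lam $ h)" if "\<xi> \<in> \<Lambda>" "y \<le> obj lam \<xi>" for \<xi>
    proof -
      have le: "ereal ?s \<le> dual_term G vbar S r h (lam $ h) \<xi>"
        using y that(2) obj_le_dual_term by (metis order_trans)
      show ?thesis
      proof (cases "lam $ h = 0")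
        case True
        then show ?thesis using le by (auto simp: dual_term_zero split: if_splits)
      next
        case False
        then have pos: "0 < lam $ h" using lam0[of h] by simp
        then have "q h \<xi> / (4 * lam $ h) \<le> C - lam $ h * (r h)\<^sup>2 - ?s"
          using le C[OF that(1)] by (simp add: dual_term_pos payoff_def)
        then show ?thesis using pos by (simp add: pos_divide_le_eq)
      qed
    qed
    then show "\<exists>B. \<forall>\<xi>\<in>{\<xi> \<in> \<Lambda>. y \<le> obj lam \<xi>}. q h \<xi> \<le> B" by blast
  qed
  ultimately show "compact {\<xi> \<in> \<Lambda>. y \<le> obj lam \<xi>}" by (simp add: compact_eq_bounded_closed)
qed

end

context robust_allocation
begin

section \<open>Estimates for perturbing a limit point\<close>

lemma payoff_segment_ge:
  assumes qx: "q h x \<noteq> 0" and r: "r h \<noteq> 0" and l: "l = sqrt (q h x) / (2 * \<bar>r h\<bar>)" and t: "0 \<le> t"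
  shows "(1 - t) * worst_case h x + t * worst_case h z - t\<^sup>2 * (q h (z - x) / (4 * l))
    \<le> payoff h l (x + t *\<^sub>R (z - x))"
proof -
  define s where "s = sqrt (q h x)"
  define b where "b = bil_on (K h) (S h) x (z - x)"
  have s: "0 < s" using qx by (simp add: s_def less_le)
  have l_pos: "0 < l" and two_l: "2 * l * \<bar>r h\<bar> = s" using s r by (simp_all add: l s_def)
  have payoff_x: "payoff h l x = worst_case h x"
    using l_pos two_l by (simp add: payoff_eq_worst_case s_def)
  have "payoff h l (x + t *\<^sub>R (z - x)) =
      payoff h l x + t * (dot_on (K h) (z - x) vbar - b / (2 * l)) - t\<^sup>2 * (q h (z - x) / (4 * l))"
    unfolding payoff_def quad_on_add_scaleR[OF psd] b_def[symmetric] dot_on_left_linear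
    using l_pos by (simp add: field_simps)
  \<comment> \<open>The directional derivative of the payoff at \<open>x\<close> towards
    \<open>z\<close> dominates the difference of the worst cases, by Cauchy-Schwarz; only the
    quadratic term is lost.\<close>
  moreover have "worst_case h z - worst_case h x \<le> dot_on (K h) (z - x) vbar - b / (2 * l)"
  proof -
    have "bil_on (K h) (S h) x z = b + s\<^sup>2"
    proof -
      have "bil_on (K h) (S h) (z - x) x = bil_on (K h) (S h) z x - q h x"
        by (simp add: quad_on_eq_bil_on bil_on_eq_dot_on dot_on_left_linear)
      then show ?thesis
        by (simp add: b_def s_def bil_on_commute[OF psd, of h x z] bil_on_commute[OF psd, of h x "z - x"])
    qed
    then have "b \<le> s * sqrt (q h z) - s\<^sup>2"
      using bil_on_le_sqrt[OF psd, of h x z] by (simp add: s_def)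
    then have "b / (2 * l) \<le> (s * sqrt (q h z) - s\<^sup>2) / (2 * l)"
      using l_pos by (intro divide_right_mono) auto
    also have "\<dots> = \<bar>r h\<bar> * sqrt (q h z) - \<bar>r h\<bar> * s"
      using l_pos unfolding two_l[symmetric] by (simp add: field_simps power2_eq_square)
    finally show ?thesis by (simp add: worst_case_def s_def dot_on_left_linear)
  qed
  then have "t * (worst_case h z - worst_case h x) \<le> t * (dot_on (K h) (z - x) vbar - b / (2 * l))"
    using t by (rule mult_left_mono)
  ultimately show ?thesis by (simp add: payoff_x algebra_simps)
qed

text \<open>For \<open>L < 0\<close> the zero vector costs only \<open>l * (r h)\<^sup>2\<close>,
  which is small. For \<open>L = 0\<close> the factor \<open>2 * l * D / q h y\<close> maximizes
  \<open>s * D - s\<^sup>2 * q h y / (4 * l)\<close>; the resulting payoff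
  \<open>l * (D\<^sup>2 / q h y - (r h)\<^sup>2)\<close> is positive because the worst case of
  \<open>y\<close> is.\<close>

lemma payoff_gt_at_small_multiplier:
  assumes "L \<le> 0" "L < 0 \<or> 0 < worst_case h y" and r: "0 < r h"
  shows "\<exists>l0>0. \<forall>l. 0 < l \<and> l < l0 \<longrightarrow> (\<exists>s. 0 \<le> s \<and> s \<le> 1 \<and> L < payoff h l (s *\<^sub>R y))"
proof (cases "L < 0")
  case True
  have "L < payoff h l (0 *\<^sub>R y)" if "0 < l" "l < - L / (r h)\<^sup>2" for l
    using that r by (simp add: payoff_def dot_on_left_linear field_simps)
  moreover have "0 < - L / (r h)\<^sup>2" using True r by (intro divide_pos_pos) auto
  ultimately show ?thesis by (intro exI[of _ "- L / (r h)\<^sup>2"]) (metis order_refl zero_le_one)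
next
  case False
  then have L: "L = 0" and wc: "0 < worst_case h y" using assms by auto
  define D where "D = dot_on (K h) y vbar"
  have D: "r h * sqrt (q h y) < D" using wc r by (simp add: worst_case_def D_def)
  have D_pos: "0 < D" using D r by (intro le_less_trans[OF _ D]) simp
  have "q h y \<noteq> 0"
  proof
    assume "q h y = 0"
    then have "D = 0" by (simp add: q_eq_0_iff D_def dot_on_def)
    then show False using D_pos by simp
  qed
  then have qy: "0 < q h y" by (simp add: less_le)
  have "(r h * sqrt (q h y))\<^sup>2 < D\<^sup>2" using D r by (intro power_strict_mono) auto
  then have rD: "(r h)\<^sup>2 < D\<^sup>2 / q h y" using qy by (simp add: power_mult_distrib pos_less_divide_eq)
  have "\<exists>s. 0 \<le> s \<and> s \<le> 1 \<and> L < payoff h l (s *\<^sub>R y)" if l: "0 < l" "l < q h y / (2 * D)" for l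
  proof (intro exI conjI)
    let ?s = "2 * l * D / q h y"
    show "0 \<le> ?s" using l D_pos by simp
    show "?s \<le> 1" using l D_pos qy by (simp add: field_simps)
    have "payoff h l (?s *\<^sub>R y) = l * (D\<^sup>2 / q h y - (r h)\<^sup>2)"
      unfolding payoff_def quad_on_scaleR dot_on_left_linear D_def[symmetric]
      using l qy by (simp add: field_simps power2_eq_square)
    also have "\<dots> > 0" using l rD by simp
    finally show "L < payoff h l (?s *\<^sub>R y)" using L by simp
  qed
  then show ?thesis using qy D_pos by (intro exI[of _ "q h y / (2 * D)"]) simp
qed

lemma worst_case_scaleR: "0 \<le> t \<Longrightarrow> worst_case h (t *\<^sub>R x) = t * worst_case h x"
  by (simp add: worst_case_def dot_on_left_linear quad_on_scaleR real_sqrt_mult algebra_simps)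

lemma worst_case_eq_0: "q h x = 0 \<Longrightarrow> worst_case h x = 0"
  by (simp add: worst_case_def q_eq_0_iff dot_on_def)

lemma worst_value_zero: "worst_value 0 = 0"
  by (simp add: worst_value_def worst_case_eq_0)

lemma tendsto_best_multiplier:
  assumes "(\<xi> \<longlongrightarrow> x) F" shows "((\<lambda>k. best_multiplier (\<xi> k)) \<longlongrightarrow> best_multiplier x) F"
proof -
  have "continuous_on UNIV best_multiplier"
    unfolding best_multiplier_def divide_inverse by (intro continuous_on_vec_lambda continuous_intros)
  then show ?thesis using assms by (simp add: continuous_on_eq_continuous_at isCont_tendsto_compose)
qed

lemma tendsto_worst_value:
  assumes "(\<xi> \<longlongrightarrow> x) F" shows "((\<lambda>k. worst_value (\<xi> k)) \<longlongrightarrow> worst_value x) F"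
  unfolding worst_value_def
proof (rule tendsto_MIN)
  fix h
  have "isCont (worst_case h) x"
    using continuous_on_worst_case[of UNIV h] by (simp add: continuous_on_eq_continuous_at)
  then show "((\<lambda>k. worst_case h (\<xi> k)) \<longlongrightarrow> worst_case h x) F"
    using assms by (rule isCont_tendsto_compose)
qed

lemma SUP_obj_eq:
  assumes "\<And>h. r h \<noteq> 0" "z \<in> \<Lambda>" "\<And>x. x \<in> \<Lambda> \<Longrightarrow> worst_value x \<le> worst_value z"
  shows "(SUP (lam, \<xi>)\<in>Dom. obj lam \<xi>) = ereal (worst_value z)"
  using obj_max_iff[of "best_multiplier z" z] obj_max_on_Dom[OF assms]
  by (simp add: is_max_on_def obj_best_multiplier[OF assms(1)])

end

section \<open>Convergence of the alternating steps\<close>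

locale alternating = robust_allocation G vbar S r A
  for G :: "'g::finite \<Rightarrow> 'n::finite set"
    and vbar :: "real ^ ('n \<times> 'm::finite)"
    and S :: "'g \<Rightarrow> real ^ ('n \<times> 'm) ^ ('n \<times> 'm)"
    and r :: "'g \<Rightarrow> real"
    and A :: "(real ^ ('n \<times> 'm)) set" +
  fixes lam :: "nat \<Rightarrow> real ^ 'g" and \<xi> :: "nat \<Rightarrow> real ^ ('n \<times> 'm)"
  assumes convex_A: "convex A"
    and r_pos: "0 < r h"
    and run: "alternating_run G vbar S r \<Lambda> lam \<xi>"
begin

lemma r_nonzero: "r h \<noteq> 0"
  using r_pos[of h] by simp

lemma lam_eq: "lam k = best_multiplier (\<xi> k)"
  using run r_pos by (simp add: alternating_run_def lambda_step_def best_multiplier_def abs_of_pos)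

lemma \<xi>_in_\<Lambda>: "\<xi> k \<in> \<Lambda>"
  using run by (cases k) (auto simp: alternating_run_def is_max_on_def)

lemma obj_run: "obj (lam k) (\<xi> k) = ereal (worst_value (\<xi> k))"
  by (simp add: lam_eq obj_best_multiplier r_nonzero)

text \<open>Every \<open>x\<close> competes in the second step, and re-optimizing the multipliers
  afterwards cannot lower the value.\<close>

lemma obj_le_next:
  assumes "x \<in> \<Lambda>" shows "obj (lam k) x \<le> ereal (worst_value (\<xi> (Suc k)))"
proof -
  have "is_max_on (obj (lam k)) \<Lambda> (\<xi> (Suc k))" using run unfolding alternating_run_def by blast
  then have "obj (lam k) x \<le> obj (lam k) (\<xi> (Suc k))" using assms by (simp add: is_max_on_def)
  also have "\<dots> \<le> ereal (worst_value (\<xi> (Suc k)))"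
    by (intro obj_le_worst_value) (simp add: lam_eq best_multiplier_nonneg)
  finally show ?thesis .
qed

lemma incseq_worst_value: "incseq (\<lambda>k. worst_value (\<xi> k))"
  using obj_le_next[OF \<xi>_in_\<Lambda>] by (intro incseq_SucI) (metis obj_run ereal_less_eq(3))

text \<open>A block with vanishing form has worst case 0, which a positive and nondecreasing worst
  value excludes.\<close>

lemma lam_pos_of_positive_start:
  assumes "0 < obj (lam 0) (\<xi> 0)" shows "0 < lam k $ h"
proof -
  have "0 < worst_value (\<xi> 0)" using assms by (simp add: obj_run)
  also have "\<dots> \<le> worst_value (\<xi> k)" using incseq_worst_value by (simp add: incseq_def)
  also have "\<dots> \<le> worst_case h (\<xi> k)" by (rule worst_value_le)
  finally have "q h (\<xi> k) \<noteq> 0" using worst_case_eq_0[of h "\<xi> k"] by auto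
  then show ?thesis using r_nonzero by (simp add: lam_eq best_multiplier_def less_le)
qed

lemma ex_maximizer: "\<exists>z\<in>\<Lambda>. \<forall>x\<in>\<Lambda>. worst_value x \<le> worst_value z"
proof (rule worst_value_max_exists)
  show "A \<noteq> {}" using \<xi>_in_\<Lambda>[of 0] in_\<Lambda>_iff by blast
qed (rule r_nonzero)

text \<open>Positive multipliers keep all dual terms finite, so a perturbation of the limit point
  can be tested as a competitor at some stage of the run.\<close>

lemma limit_point_optimal:
  assumes lam_pos: "\<And>k h. 0 < lam k $ h"
    and \<sigma>: "strict_mono \<sigma>" and lim: "(\<lambda>k. \<xi> (\<sigma> k)) \<longlonglongrightarrow> x"
  shows "x \<in> \<Lambda>" and "y \<in> \<Lambda> \<Longrightarrow> worst_value y \<le> worst_value x" and "worst_value (\<xi> k) \<le> worst_value x"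
proof -
  show x: "x \<in> \<Lambda>" using closed_sequentially[OF closed_\<Lambda> _ lim] \<xi>_in_\<Lambda> by simp
  define L where "L = worst_value x"
  have "(\<lambda>k. worst_value (\<xi> (\<sigma> k))) \<longlonglongrightarrow> L" unfolding L_def by (rule tendsto_worst_value[OF lim])
  moreover have "incseq (\<lambda>k. worst_value (\<xi> (\<sigma> k)))"
    using incseq_worst_value strict_mono_mono[OF \<sigma>] by (simp add: incseq_def mono_def)
  ultimately have le_\<sigma>: "worst_value (\<xi> (\<sigma> k)) \<le> L" for k by (rule incseq_le[rotated])
  have le_L: "worst_value (\<xi> k) \<le> L" for k
    using incseq_worst_value seq_suble[OF \<sigma>, of k] le_\<sigma>[of k] unfolding incseq_def by (meson order_trans)
  then show "worst_value (\<xi> k) \<le> worst_value x" by (simp add: L_def)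
  have lam_lim: "(\<lambda>k. lam (\<sigma> k) $ h) \<longlonglongrightarrow> best_multiplier x $ h" for h
    unfolding lam_eq by (intro tendsto_vec_nth tendsto_best_multiplier lim)
  obtain z where z: "z \<in> \<Lambda>" "\<And>y. y \<in> \<Lambda> \<Longrightarrow> worst_value y \<le> worst_value z" using ex_maximizer by blast
  have "worst_value z \<le> L"
  proof (rule ccontr)
    assume "\<not> worst_value z \<le> L"
    define M where "M = worst_value z"
    have LM: "L < M" using \<open>\<not> worst_value z \<le> L\<close> by (simp add: M_def)
    \<comment> \<open>The zero vector belongs to the region and has worst value 0.\<close>
    have M_nonneg: "0 \<le> M"
      using z(2)[of 0] \<Lambda>_shrink[OF z(1), of 0] by (force simp: M_def worst_value_zero)
    define C where "C h = q h (z - x) / (4 * best_multiplier x $ h)" for h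
    have C_nonneg: "0 \<le> C h" for h by (simp add: C_def best_multiplier_def)
    \<comment> \<open>Small enough that in each group the quadratic loss
      \<open>t\<^sup>2 * C h\<close> stays below the linear gain \<open>t * (M - L)\<close>.\<close>
    define t where "t = min 1 ((M - L) / (2 * (1 + sum C UNIV)))"
    have sumC: "0 \<le> sum C UNIV" by (intro sum_nonneg C_nonneg)
    have t: "0 < t" "t \<le> 1" using LM sumC by (auto simp: t_def)
    have tC: "t * C h < M - L" for h
    proof -
      have "t * C h \<le> t * (1 + sum C UNIV)"
        using t member_le_sum[of h UNIV C] C_nonneg by (intro mult_left_mono) auto
      also have "\<dots> \<le> (M - L) / (2 * (1 + sum C UNIV)) * (1 + sum C UNIV)"
        using sumC by (intro mult_right_mono) (auto simp: t_def)
      also have "\<dots> = (M - L) / 2" using sumC by (simp add: field_simps)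
      finally show ?thesis using LM by simp
    qed
    define y where "y = x + t *\<^sub>R (z - x)"
    have y: "y \<in> \<Lambda>" unfolding y_def using t by (intro convex_\<Lambda>_segment convex_A x z) auto
    have "\<forall>\<^sub>F k in sequentially. \<exists>s. 0 \<le> s \<and> s \<le> 1 \<and> L < payoff h (lam (\<sigma> k) $ h) (s *\<^sub>R y)" for h
    proof (cases "q h x = 0")
      \<comment> \<open>Vanishing limit multiplier: the block of \<open>x\<close> is zero, so
        \<open>y\<close> is \<open>t *\<^sub>R z\<close> there and a suitable scaling beats
        \<open>L\<close>.\<close>
      case True
      then have x0: "x $ p = 0" if "p \<in> K h" for p using that by (simp add: q_eq_0_iff)
      have "L \<le> 0" using worst_value_le[of x h] worst_case_eq_0[OF True] by (simp add: L_def)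
      moreover have "worst_case h y = t * worst_case h z"
        using worst_case_cong[of h y "t *\<^sub>R z"] x0 t by (simp add: y_def worst_case_scaleR)
      then have "L < 0 \<or> 0 < worst_case h y"
        using LM worst_value_le[of z h] t M_nonneg by (cases "L < 0") (auto simp: M_def)
      ultimately obtain l0 where l0: "0 < l0"
          "\<And>l. 0 < l \<Longrightarrow> l < l0 \<Longrightarrow> \<exists>s. 0 \<le> s \<and> s \<le> 1 \<and> L < payoff h l (s *\<^sub>R y)"
        using payoff_gt_at_small_multiplier[of L h y] r_pos by blast
      have "best_multiplier x $ h < l0" using True l0(1) by (simp add: best_multiplier_def)
      then have "\<forall>\<^sub>F k in sequentially. lam (\<sigma> k) $ h < l0" using lam_lim by (rule order_tendstoD(2)[rotated])
      then show ?thesis by eventually_elim (use l0(2) lam_pos in blast)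
    next
      \<comment> \<open>Positive limit multiplier: the factor 1 suffices, since the payoff is
        continuous in the multiplier there.\<close>
      case False
      let ?l = "best_multiplier x $ h"
      have l: "0 < ?l" using False r_nonzero by (simp add: best_multiplier_def less_le)
      have "t * (t * C h) < t * (M - L)" using tC t by (intro mult_strict_left_mono) auto
      then have "L < (1 - t) * L + t * M - t\<^sup>2 * C h" by (simp add: algebra_simps power2_eq_square)
      also have "\<dots> \<le> (1 - t) * worst_case h x + t * worst_case h z - t\<^sup>2 * C h"
        using t worst_value_le[of x h] worst_value_le[of z h]
        by (intro diff_right_mono add_mono mult_left_mono) (auto simp: L_def M_def)
      also have "\<dots> \<le> payoff h ?l y"
        unfolding y_def C_def using False r_nonzero t by (intro payoff_segment_ge) (auto simp: best_multiplier_def)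
      finally have "L < payoff h ?l (1 *\<^sub>R y)" by simp
      moreover have "(\<lambda>k. payoff h (lam (\<sigma> k) $ h) (1 *\<^sub>R y)) \<longlonglongrightarrow> payoff h ?l (1 *\<^sub>R y)"
        unfolding payoff_def using l by (intro tendsto_intros lam_lim) auto
      ultimately have "\<forall>\<^sub>F k in sequentially. L < payoff h (lam (\<sigma> k) $ h) (1 *\<^sub>R y)"
        by (rule order_tendstoD(1)[rotated])
      then show ?thesis by eventually_elim (metis order_refl zero_le_one)
    qed
    then have "\<forall>\<^sub>F k in sequentially. \<forall>h. \<exists>s. 0 \<le> s \<and> s \<le> 1 \<and> L < payoff h (lam (\<sigma> k) $ h) (s *\<^sub>R y)"
      by (rule eventually_all_finite)
    from eventually_happens'[OF sequentially_bot this] obtain k where "\<forall>h. \<exists>s. 0 \<le> s \<and> s \<le> 1 \<and> L < payoff h (lam (\<sigma> k) $ h) (s *\<^sub>R y)"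
      by blast
    from choice[OF this] obtain s where s: "\<And>h. 0 \<le> s h" "\<And>h. s h \<le> 1"
      "\<And>h. L < payoff h (lam (\<sigma> k) $ h) (s h *\<^sub>R y)" by blast
    \<comment> \<open>Each block of \<open>y\<close> gets its own factor. The result stays in the
      region and beats \<open>L\<close>, although no step of the run exceeds
      \<open>L\<close>.\<close>
    obtain \<eta> :: "real ^ ('n \<times> 'm)" where \<eta>: "\<And>h p. p \<in> K h \<Longrightarrow> \<eta> $ p = (s h *\<^sub>R y) $ p"
      using glue[of "\<lambda>h. s h *\<^sub>R y"] by blast
    have "\<eta> \<in> \<Lambda>"
    proof (rule \<Lambda>_shrink[OF y])
      fix p
      obtain h where h: "p \<in> K h" using ex_block by blast
      show "\<exists>c. 0 \<le> c \<and> c \<le> 1 \<and> \<eta> $ p = c * y $ p"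
        using s(1,2)[of h] \<eta>[OF h] by (intro exI[of _ "s h"]) simp
    qed
    then have "obj (lam (\<sigma> k)) \<eta> \<le> ereal L"
      using obj_le_next[of \<eta> "\<sigma> k"] le_L[of "Suc (\<sigma> k)"] by (meson ereal_less_eq(3) order_trans)
    moreover have "obj (lam (\<sigma> k)) \<eta> > ereal L"
    proof -
      obtain h where h: "(MIN h. payoff h (lam (\<sigma> k) $ h) \<eta>) = payoff h (lam (\<sigma> k) $ h) \<eta>"
        using MIN_in[of "\<lambda>h. payoff h (lam (\<sigma> k) $ h) \<eta>"] by blast
      have "payoff h (lam (\<sigma> k) $ h) \<eta> = payoff h (lam (\<sigma> k) $ h) (s h *\<^sub>R y)"
        by (rule payoff_cong) (rule \<eta>)
      then show ?thesis using s(3)[of h] h by (simp add: obj_pos[OF lam_pos])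
    qed
    ultimately show False by simp
  qed
  then show "worst_value y \<le> worst_value x" if "y \<in> \<Lambda>" using z(2)[OF that] by (simp add: L_def)
qed

lemma ex_convergent_subsequence: "\<exists>\<sigma> x. strict_mono \<sigma> \<and> (\<lambda>k. \<xi> (\<sigma> k)) \<longlonglongrightarrow> x"
proof -
  have "worst_value (\<xi> 0) \<le> worst_value (\<xi> k)" for k using incseq_worst_value by (simp add: incseq_def)
  then have "bounded (range \<xi>)"
    using \<xi>_in_\<Lambda> by (intro bounded_subset[OF bounded_worst_value_superlevel[OF r_nonzero, of "worst_value (\<xi> 0)"]]) auto
  then show ?thesis using bounded_imp_convergent_subsequence[of \<xi>] by (auto simp: o_def)
qed

lemma convergence:
  assumes lam_pos: "\<And>k h. 0 < lam k $ h"
  shows "incseq (\<lambda>k. obj (lam k) (\<xi> k))"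
    and "(\<lambda>k. obj (lam k) (\<xi> k)) \<longlonglongrightarrow> (SUP (lam', \<xi>')\<in>Dom. obj lam' \<xi>')"
    and "\<exists>\<sigma> lam' \<xi>'. strict_mono \<sigma> \<and> (lam \<circ> \<sigma>) \<longlonglongrightarrow> lam' \<and> (\<xi> \<circ> \<sigma>) \<longlonglongrightarrow> \<xi>'"
    and "\<And>\<sigma> lam' \<xi>'. strict_mono \<sigma> \<Longrightarrow> (lam \<circ> \<sigma>) \<longlonglongrightarrow> lam' \<Longrightarrow> (\<xi> \<circ> \<sigma>) \<longlonglongrightarrow> \<xi>' \<Longrightarrow>
       is_max_on (\<lambda>(lam, \<xi>). obj lam \<xi>) Dom (lam', \<xi>')"
proof -
  show "incseq (\<lambda>k. obj (lam k) (\<xi> k))"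
    using incseq_worst_value by (simp add: obj_run incseq_def)
  obtain \<sigma> x where \<sigma>: "strict_mono \<sigma>" "(\<lambda>k. \<xi> (\<sigma> k)) \<longlonglongrightarrow> x" using ex_convergent_subsequence by blast
  have "(lam \<circ> \<sigma>) \<longlonglongrightarrow> best_multiplier x"
    using tendsto_best_multiplier[OF \<sigma>(2)] by (simp add: o_def lam_eq)
  then show "\<exists>\<sigma> lam' \<xi>'. strict_mono \<sigma> \<and> (lam \<circ> \<sigma>) \<longlonglongrightarrow> lam' \<and> (\<xi> \<circ> \<sigma>) \<longlonglongrightarrow> \<xi>'"
    using \<sigma> by (auto simp: o_def)
  note x = limit_point_optimal[OF lam_pos \<sigma>]
  \<comment> \<open>Monotonicity gives convergence of the whole sequence of values; the subsequence
    only identifies the limit.\<close>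
  obtain L where L: "(\<lambda>k. worst_value (\<xi> k)) \<longlonglongrightarrow> L"
    using incseq_convergent[OF incseq_worst_value, of "worst_value x"] x(3) by blast
  have "(\<lambda>k. worst_value (\<xi> (\<sigma> k))) \<longlonglongrightarrow> L"
    using LIMSEQ_subseq_LIMSEQ[OF L \<sigma>(1)] by (simp add: o_def)
  then have "L = worst_value x"
    using tendsto_worst_value[OF \<sigma>(2)] LIMSEQ_unique by blast
  then show "(\<lambda>k. obj (lam k) (\<xi> k)) \<longlonglongrightarrow> (SUP (lam', \<xi>')\<in>Dom. obj lam' \<xi>')"
    using L SUP_obj_eq[OF r_nonzero x(1,2)] by (simp add: obj_run)
  fix \<tau> lam' \<xi>' assume \<tau>: "strict_mono \<tau>" "(lam \<circ> \<tau>) \<longlonglongrightarrow> lam'" "(\<xi> \<circ> \<tau>) \<longlonglongrightarrow> \<xi>'"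
  have \<xi>': "(\<lambda>k. \<xi> (\<tau> k)) \<longlonglongrightarrow> \<xi>'" using \<tau>(3) by (simp add: o_def)
  have "(lam \<circ> \<tau>) \<longlonglongrightarrow> best_multiplier \<xi>'"
    using tendsto_best_multiplier[OF \<xi>'] by (simp add: o_def lam_eq)
  then have "lam' = best_multiplier \<xi>'" using \<tau>(2) LIMSEQ_unique by blast
  then show "is_max_on (\<lambda>(lam, \<xi>). obj lam \<xi>) Dom (lam', \<xi>')"
    using obj_max_on_Dom[OF r_nonzero limit_point_optimal(1,2)[OF lam_pos \<tau>(1) \<xi>']] by simp
qed

end

section \<open>Polyhedral structure of the feasible sets\<close>

lemma feasible_eq:
  "feasible \<kappa>l \<kappa>u \<psi>l \<psi>u c = {a. (\<forall>p. 0 \<le> a $ p) \<and> (\<forall>p. a $ p \<le> c $ p) \<and>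
     (\<forall>j. \<kappa>l $ j \<le> (\<Sum>i\<in>UNIV. a $ (j, i))) \<and> (\<forall>j. (\<Sum>i\<in>UNIV. a $ (j, i)) \<le> \<kappa>u $ j) \<and>
     (\<forall>i. \<psi>l $ i \<le> (\<Sum>j\<in>UNIV. a $ (j, i))) \<and> (\<forall>i. (\<Sum>j\<in>UNIV. a $ (j, i)) \<le> \<psi>u $ i)}"
  by (auto simp: feasible_def less_eq_vec_def)

lemma compact_feasible: "compact (feasible \<kappa>l \<kappa>u \<psi>l \<psi>u c)"
proof -
  have "closed (feasible \<kappa>l \<kappa>u \<psi>l \<psi>u c)"
    unfolding feasible_eq
    by (intro closed_Collect_all closed_Collect_conj closed_Collect_le continuous_intros)
  moreover have "\<bar>a $ p\<bar> \<le> c $ p" if "a \<in> feasible \<kappa>l \<kappa>u \<psi>l \<psi>u c" for a p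
    using that by (simp add: feasible_eq)
  then have "bounded (feasible \<kappa>l \<kappa>u \<psi>l \<psi>u c)" by (intro bounded_coordinates) blast
  ultimately show ?thesis by (simp add: compact_eq_bounded_closed)
qed

text \<open>A linear functional is the inner product with the image of 1 under its adjoint, so these
  sets are half-spaces.\<close>

lemma polyhedron_linear_le:
  fixes f :: "'a::euclidean_space \<Rightarrow> real"
  assumes "linear f" shows "polyhedron {x. f x \<le> b}" and "polyhedron {x. b \<le> f x}"
proof -
  obtain v where v: "f = (\<lambda>x. v \<bullet> x)"
    using adjoint_works[OF assms, where y = 1] by (intro that[of "adjoint f 1"]) (simp add: fun_eq_iff inner_commute)
  show "polyhedron {x. f x \<le> b}" unfolding v by (rule polyhedron_halfspace_le)
  show "polyhedron {x. b \<le> f x}" unfolding v by (rule polyhedron_halfspace_ge)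
qed

lemma polyhedron_Collect_conj:
  "polyhedron {x. P x} \<Longrightarrow> polyhedron {x. Q x} \<Longrightarrow> polyhedron {x. P x \<and> Q x}"
  by (simp add: Collect_conj_eq)

lemma polyhedron_Collect_all:
  fixes P :: "'i::finite \<Rightarrow> 'a::euclidean_space \<Rightarrow> bool"
  assumes "\<And>i. polyhedron {x. P i x}" shows "polyhedron {x. \<forall>i. P i x}"
proof -
  have "polyhedron (\<Inter>i. {x. P i x})" using assms by (intro polyhedron_Inter) auto
  then show ?thesis by (simp add: Collect_all_eq)
qed

text \<open>An extended formulation of \<open>lower_shift\<close>: the second component is an
  allocation witnessing membership of the first, and forgetting it is a projection.\<close>

lemma polyhedron_lift:
  "polyhedron {x :: (real ^ ('n \<times> 'm)) \<times> (real ^ ('n::finite \<times> 'm::finite)).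
     snd x \<in> feasible \<kappa>l \<kappa>u \<psi>l \<psi>u c \<and> (\<forall>p. fst x $ p - snd x $ p \<le> 0)}"
  unfolding feasible_eq mem_Collect_eq
  by (intro polyhedron_Collect_conj polyhedron_Collect_all polyhedron_linear_le)
    (auto intro!: linearI simp: algebra_simps sum.distrib sum_distrib_left)

lemma convex_feasible: "convex (feasible \<kappa>l \<kappa>u \<psi>l \<psi>u c)"
  unfolding feasible_eq
  by (intro polyhedron_imp_convex polyhedron_Collect_conj polyhedron_Collect_all polyhedron_linear_le)
    (auto intro!: linearI simp: algebra_simps sum.distrib sum_distrib_left)

lemma lower_shift_feasible_polyhedral:
  "\<exists>P :: ((real ^ ('n \<times> 'm)) \<times> (real ^ ('n \<times> 'm))) set.
     polyhedron P \<and> lower_shift (feasible \<kappa>l \<kappa>u \<psi>l \<psi>u (c :: real ^ ('n::finite \<times> 'm::finite))) = fst ` P"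
proof (intro exI conjI)
  let ?P = "{x. snd x \<in> feasible \<kappa>l \<kappa>u \<psi>l \<psi>u c \<and> (\<forall>p. fst x $ p - snd x $ p \<le> 0)}"
  show "polyhedron ?P" by (rule polyhedron_lift)
  show "lower_shift (feasible \<kappa>l \<kappa>u \<psi>l \<psi>u c) = fst ` ?P"
  proof (intro set_eqI iffI)
    fix x assume "x \<in> lower_shift (feasible \<kappa>l \<kappa>u \<psi>l \<psi>u c)"
    then obtain a \<mu> where a: "a \<in> feasible \<kappa>l \<kappa>u \<psi>l \<psi>u c" "0 \<le> \<mu>" "x = a - \<mu>"
      by (auto simp: lower_shift_def)
    then have "(x, a) \<in> ?P" by (simp add: less_eq_vec_def)
    then show "x \<in> fst ` ?P" by (rule rev_image_eqI) simp
  next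
    fix x assume "x \<in> fst ` ?P"
    then obtain a where "a \<in> feasible \<kappa>l \<kappa>u \<psi>l \<psi>u c" "\<forall>p. x $ p - a $ p \<le> 0" by auto
    then have "x = a - (a - x) \<and> a \<in> feasible \<kappa>l \<kappa>u \<psi>l \<psi>u c \<and> 0 \<le> a - x"
      by (simp add: less_eq_vec_def)
    then show "x \<in> lower_shift (feasible \<kappa>l \<kappa>u \<psi>l \<psi>u c)" unfolding lower_shift_def by blast
  qed
qed

text \<open>Convergence is restricted to runs with positive multipliers because a zero multiplier
  persists: it forces the next \<xi> to vanish on that block, so the value cannot rise above 0
  afterwards. Attainment of the dual needs nonzero radii because with a zero radius the best
  multiplier may be infinite.\<close>

theorem corollary3p7:
  fixes G :: "'g::finite \<Rightarrow> 'n::finite set"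
    and \<kappa>l \<kappa>u :: "real ^ 'n" and \<psi>l \<psi>u :: "real ^ 'm::finite" and c :: "real ^ ('n \<times> 'm)"
    and vbar :: "real ^ ('n \<times> 'm)"
    and S :: "'g \<Rightarrow> real ^ ('n \<times> 'm) ^ ('n \<times> 'm)"
    and r :: "'g \<Rightarrow> real"
  defines "A \<equiv> feasible \<kappa>l \<kappa>u \<psi>l \<psi>u c"
    and "\<Lambda> \<equiv> lower_shift (feasible \<kappa>l \<kappa>u \<psi>l \<psi>u c)"
    and "V \<equiv> uncertainty G vbar S r"
    and "Dom \<equiv> {lam :: real ^ 'g. 0 \<le> lam} \<times> lower_shift (feasible \<kappa>l \<kappa>u \<psi>l \<psi>u c)"
    and "obj \<equiv> dual_objective G vbar S r"
  assumes groups: "inj G" "partition_on UNIV (range G)"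
    and vbar: "0 \<le> vbar"
    and S: "\<forall>h. psd_on (block (G h)) (S h) \<and> invertible_on (block (G h)) (S h)"
  shows
    \<comment> \<open>equivalence of the two problems\<close>
    "(SUP a\<in>A. robust_welfare G V a) = (SUP (lam, \<xi>)\<in>Dom. obj lam \<xi>)
     \<and>
     \<comment> \<open>the extrema are attained\<close>
     (\<forall>a. \<exists>v\<in>V. \<exists>h. robust_welfare G V a = ereal (group_utility G h a v)) \<and>
     (A \<noteq> {} \<longrightarrow> (\<exists>a. is_max_on (robust_welfare G V) A a)) \<and>
     (A \<noteq> {} \<and> (\<forall>h. r h \<noteq> 0) \<longrightarrow> (\<exists>p. is_max_on (\<lambda>(lam, \<xi>). obj lam \<xi>) Dom p))
     \<and>
     \<comment> \<open>recovery of an optimal allocation\<close>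
     (\<forall>lam \<xi>. is_max_on (\<lambda>(lam, \<xi>). obj lam \<xi>) Dom (lam, \<xi>) \<longrightarrow>
        (\<exists>a\<in>A. \<forall>h. \<forall>p\<in>block (G h). \<xi> $ p \<le> a $ p) \<and>
        (\<forall>a\<in>A. (\<forall>h. \<forall>p\<in>block (G h). \<xi> $ p \<le> a $ p) \<longrightarrow> is_max_on (robust_welfare G V) A a))
     \<and>
     \<comment> \<open>first step: the optimal multipliers for fixed \<open>\<xi>\<close>\<close>
     (\<forall>\<xi> h l. r h > 0 \<and> l \<ge> 0 \<and> l \<noteq> lambda_step G S r \<xi> $ h \<longrightarrow>
        dual_term G vbar S r h l \<xi> < dual_term G vbar S r h (lambda_step G S r \<xi> $ h) \<xi>)
     \<and>
     \<comment> \<open>second step: a solvable concave quadratic program; its linear constraints are expressed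
         with an auxiliary allocation variable\<close>
     (\<forall>lam. (\<forall>h. lam $ h > 0) \<longrightarrow>
        (\<forall>\<xi>. obj lam \<xi> = ereal (MIN h. dot_on (block (G h)) \<xi> vbar
               - quad_on (block (G h)) (S h) \<xi> / (4 * lam $ h) - lam $ h * (r h)\<^sup>2)) \<and>
        (\<forall>h. concave_on UNIV (\<lambda>\<xi>. dot_on (block (G h)) \<xi> vbar
               - quad_on (block (G h)) (S h) \<xi> / (4 * lam $ h) - lam $ h * (r h)\<^sup>2))) \<and>
     (\<exists>P :: ((real ^ ('n \<times> 'm)) \<times> (real ^ ('n \<times> 'm))) set. polyhedron P \<and> \<Lambda> = fst ` P) \<and>
     (\<forall>lam. A \<noteq> {} \<and> 0 \<le> lam \<longrightarrow> (\<exists>\<xi>. is_max_on (obj lam) \<Lambda> \<xi>))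
     \<and>
     \<comment> \<open>the alternating steps, as long as no multiplier vanishes, converge to exact optimal solutions\<close>
     (\<forall>lam \<xi>. (\<forall>h. r h > 0) \<and> alternating_run G vbar S r \<Lambda> lam \<xi> \<and> (\<forall>k h. lam k $ h > 0) \<longrightarrow>
        incseq (\<lambda>k. obj (lam k) (\<xi> k)) \<and>
        (\<lambda>k. obj (lam k) (\<xi> k)) \<longlonglongrightarrow> (SUP (lam', \<xi>')\<in>Dom. obj lam' \<xi>') \<and>
        (\<exists>\<sigma> lam' \<xi>'. strict_mono \<sigma> \<and> (lam \<circ> \<sigma>) \<longlonglongrightarrow> lam' \<and> (\<xi> \<circ> \<sigma>) \<longlonglongrightarrow> \<xi>') \<and>
        (\<forall>\<sigma> lam' \<xi>'. strict_mono \<sigma> \<and> (lam \<circ> \<sigma>) \<longlonglongrightarrow> lam' \<and> (\<xi> \<circ> \<sigma>) \<longlonglongrightarrow> \<xi>' \<longrightarrow>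
           is_max_on (\<lambda>(lam, \<xi>). obj lam \<xi>) Dom (lam', \<xi>')))
     \<and>
     \<comment> \<open>a start with positive objective value suffices for this\<close>
     (\<forall>lam \<xi>. (\<forall>h. r h > 0) \<and> alternating_run G vbar S r \<Lambda> lam \<xi> \<and> obj (lam 0) (\<xi> 0) > 0 \<longrightarrow>
        (\<forall>k h. lam k $ h > 0))"
proof -
  interpret robust_allocation G vbar S r A
  proof unfold_locales
    show "compact A" unfolding A_def by (rule compact_feasible)
    show "0 \<le> a $ p" if "a \<in> A" for a p using that by (simp add: A_def feasible_eq)
  qed (use groups vbar S in auto)
  have \<Lambda>_eq: "\<Lambda> = lower_shift A" by (simp add: A_def \<Lambda>_def)
  have Dom_eq: "Dom = {lam. 0 \<le> lam} \<times> lower_shift A" by (simp add: A_def Dom_def)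
  \<comment> \<open>The blocks cover all indices.\<close>
  have blockwise: "(\<forall>h. \<forall>p\<in>block (G h). \<xi> $ p \<le> a $ p) \<longleftrightarrow> (\<forall>p. \<xi> $ p \<le> a $ p)"
    for \<xi> a :: "real ^ ('n \<times> 'm)"
    using ex_block by blast
  have alt: "alternating G vbar S r A lam \<xi>" if "\<forall>h. r h > 0" "alternating_run G vbar S r (lower_shift A) lam \<xi>" for lam \<xi>
    using that convex_feasible by unfold_locales (auto simp: A_def)
  show ?thesis
    unfolding V_def obj_def \<Lambda>_eq Dom_eq
  proof (intro conjI)
    show "(SUP a\<in>A. robust_welfare G (uncertainty G vbar S r) a) =
        (SUP (lam, \<xi>)\<in>{lam. 0 \<le> lam} \<times> lower_shift A. dual_objective G vbar S r lam \<xi>)"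
      by (rule SUP_welfare_eq)
    show "\<forall>a. \<exists>v\<in>uncertainty G vbar S r. \<exists>h.
        robust_welfare G (uncertainty G vbar S r) a = ereal (group_utility G h a v)"
      unfolding group_utility_def using welfare_attained by blast
    show "A \<noteq> {} \<longrightarrow> (\<exists>a. is_max_on (robust_welfare G (uncertainty G vbar S r)) A a)"
      using welfare_max_exists by blast
    show "A \<noteq> {} \<and> (\<forall>h. r h \<noteq> 0) \<longrightarrow>
        (\<exists>p. is_max_on (\<lambda>(lam, \<xi>). dual_objective G vbar S r lam \<xi>) ({lam. 0 \<le> lam} \<times> lower_shift A) p)"
      using worst_value_max_exists obj_max_on_Dom by metis
    show "\<forall>lam \<xi>. is_max_on (\<lambda>(lam, \<xi>). dual_objective G vbar S r lam \<xi>)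
          ({lam. 0 \<le> lam} \<times> lower_shift A) (lam, \<xi>) \<longrightarrow>
        (\<exists>a\<in>A. \<forall>h. \<forall>p\<in>block (G h). \<xi> $ p \<le> a $ p) \<and>
        (\<forall>a\<in>A. (\<forall>h. \<forall>p\<in>block (G h). \<xi> $ p \<le> a $ p) \<longrightarrow>
          is_max_on (robust_welfare G (uncertainty G vbar S r)) A a)"
    proof (intro allI impI conjI)
      fix lam \<xi>
      assume max: "is_max_on (\<lambda>(lam, \<xi>). dual_objective G vbar S r lam \<xi>)
          ({lam. 0 \<le> lam} \<times> lower_shift A) (lam, \<xi>)"
      then have "\<xi> \<in> lower_shift A" by (simp add: is_max_on_def)
      then show "\<exists>a\<in>A. \<forall>h. \<forall>p\<in>block (G h). \<xi> $ p \<le> a $ p" unfolding blockwise in_\<Lambda>_iff .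
      show "\<forall>a\<in>A. (\<forall>h. \<forall>p\<in>block (G h). \<xi> $ p \<le> a $ p) \<longrightarrow>
          is_max_on (robust_welfare G (uncertainty G vbar S r)) A a"
        unfolding blockwise using recovery[OF max] by blast
    qed
    show "\<forall>\<xi> h l. r h > 0 \<and> l \<ge> 0 \<and> l \<noteq> lambda_step G S r \<xi> $ h \<longrightarrow>
        dual_term G vbar S r h l \<xi> < dual_term G vbar S r h (lambda_step G S r \<xi> $ h) \<xi>"
      using dual_term_less_lambda_step by blast
    show "\<forall>lam. (\<forall>h. lam $ h > 0) \<longrightarrow>
        (\<forall>\<xi>. dual_objective G vbar S r lam \<xi> = ereal (MIN h. dot_on (block (G h)) \<xi> vbar
               - quad_on (block (G h)) (S h) \<xi> / (4 * lam $ h) - lam $ h * (r h)\<^sup>2)) \<and>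
        (\<forall>h. concave_on UNIV (\<lambda>\<xi>. dot_on (block (G h)) \<xi> vbar
               - quad_on (block (G h)) (S h) \<xi> / (4 * lam $ h) - lam $ h * (r h)\<^sup>2))"
      using obj_pos concave_payoff unfolding payoff_def by blast
    show "\<exists>P :: ((real ^ ('n \<times> 'm)) \<times> (real ^ ('n \<times> 'm))) set. polyhedron P \<and> lower_shift A = fst ` P"
      unfolding A_def by (rule lower_shift_feasible_polyhedral)
    show "\<forall>lam. A \<noteq> {} \<and> 0 \<le> lam \<longrightarrow> (\<exists>\<xi>. is_max_on (dual_objective G vbar S r lam) (lower_shift A) \<xi>)"
      using obj_max_exists by blast
    show "\<forall>lam \<xi>. (\<forall>h. r h > 0) \<and> alternating_run G vbar S r (lower_shift A) lam \<xi> \<and> (\<forall>k h. lam k $ h > 0) \<longrightarrow>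
        incseq (\<lambda>k. dual_objective G vbar S r (lam k) (\<xi> k)) \<and>
        (\<lambda>k. dual_objective G vbar S r (lam k) (\<xi> k)) \<longlonglongrightarrow>
          (SUP (lam', \<xi>')\<in>{lam. 0 \<le> lam} \<times> lower_shift A. dual_objective G vbar S r lam' \<xi>') \<and>
        (\<exists>\<sigma> lam' \<xi>'. strict_mono \<sigma> \<and> (lam \<circ> \<sigma>) \<longlonglongrightarrow> lam' \<and> (\<xi> \<circ> \<sigma>) \<longlonglongrightarrow> \<xi>') \<and>
        (\<forall>\<sigma> lam' \<xi>'. strict_mono \<sigma> \<and> (lam \<circ> \<sigma>) \<longlonglongrightarrow> lam' \<and> (\<xi> \<circ> \<sigma>) \<longlonglongrightarrow> \<xi>' \<longrightarrow>
           is_max_on (\<lambda>(lam, \<xi>). dual_objective G vbar S r lam \<xi>) ({lam. 0 \<le> lam} \<times> lower_shift A) (lam', \<xi>'))"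
    proof (intro allI impI)
      fix lam \<xi>
      assume *: "(\<forall>h. r h > 0) \<and> alternating_run G vbar S r (lower_shift A) lam \<xi> \<and> (\<forall>k h. lam k $ h > 0)"
      then interpret alternating G vbar S r A lam \<xi> by (intro alt) auto
      have pos: "\<And>k h. 0 < lam k $ h" using * by blast
      show "incseq (\<lambda>k. dual_objective G vbar S r (lam k) (\<xi> k)) \<and>
        (\<lambda>k. dual_objective G vbar S r (lam k) (\<xi> k)) \<longlonglongrightarrow>
          (SUP (lam', \<xi>')\<in>{lam. 0 \<le> lam} \<times> lower_shift A. dual_objective G vbar S r lam' \<xi>') \<and>
        (\<exists>\<sigma> lam' \<xi>'. strict_mono \<sigma> \<and> (lam \<circ> \<sigma>) \<longlonglongrightarrow> lam' \<and> (\<xi> \<circ> \<sigma>) \<longlonglongrightarrow> \<xi>') \<and>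
        (\<forall>\<sigma> lam' \<xi>'. strict_mono \<sigma> \<and> (lam \<circ> \<sigma>) \<longlonglongrightarrow> lam' \<and> (\<xi> \<circ> \<sigma>) \<longlonglongrightarrow> \<xi>' \<longrightarrow>
           is_max_on (\<lambda>(lam, \<xi>). dual_objective G vbar S r lam \<xi>) ({lam. 0 \<le> lam} \<times> lower_shift A) (lam', \<xi>'))"
        by (intro conjI allI impI convergence[OF pos]) auto
    qed
    show "\<forall>lam \<xi>. (\<forall>h. r h > 0) \<and> alternating_run G vbar S r (lower_shift A) lam \<xi> \<and>
        dual_objective G vbar S r (lam 0) (\<xi> 0) > 0 \<longrightarrow> (\<forall>k h. lam k $ h > 0)"
      using alternating.lam_pos_of_positive_start[OF alt] by blast
  qed
qed

end
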